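(* Let $\beta\in\,]0,+\infty[$ and let $f\colon H\to\mathbb R$ be convex, differentiable, and such that $\nabla f$ is $1/\beta$-Lipschitzian, with $\operatorname{Argmin}f\ne\varnothing$. Let $(K,\mathcal K)$ be a measurable space, let $k\colon(\Omega,\mathcal F,\mathbb P)\to(K,\mathcal K)$ be a random variable, let $\xi\in\,]0,+\infty[$, and, for every $\mathsf k\in K$, let $g_{\mathsf k}\colon H\to\mathbb R$ be differentiable and such that $(K\times H,\mathcal K\otimes\mathcal B_H)\to(H,\mathcal B_H)\colon(\mathsf k,\mathsf x)\mapsto\nabla g_{\mathsf k}(\mathsf x)$ is measurable and $$(\forall\mathsf x\in H)\quad\mathsf E\nabla g_k(\mathsf x)=\nabla f(\mathsf x)\quad\text{and}\quad\mathsf E\|\nabla g_k(\mathsf x)-\nabla f(\mathsf x)\|^2\le\xi.$$ Let $\nu\in\,]2/3,1]$ and $x_0\in L^2(\Omega,\mathcal F,\mathbb P;H)$. For every $n\in\mathbb N$, set $\mathcal X_n=\sigma(x_0,\dots,x_n)$, let $k_n$ be a copy of $k$ that is independent of $\mathcal X_n$, set $\gamma_n=2\beta/(n+1)^\nu$, and $$x_{n+1}=x_n-\gamma_n\nabla g_{k_n}(x_n).$$ Then the following hold for some $x\in L^2(\Omega,\mathcal F,\mathbb P;\operatorname{Argmin}f)$: (i) $(\nabla f(x_n))_{n\in\mathbb N}$ converges strongly in $L^1(\Omega,\mathcal F,\mathbb P;H)$ and strongly a.s. to $0$. (ii) $(x_n)_{n\in\mathbb N}$ converges weakly in $L^2(\Omega,\mathcal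 F,\mathbb P;H)$ and weakly a.s. to $x$. (iii) Suppose that $\nabla f$ is demiregular at every point in $\operatorname{Argmin}f$. Then $(x_n)_{n\in\mathbb N}$ converges strongly in $L^1(\Omega,\mathcal F,\mathbb P;H)$ and strongly a.s. to $x$.
   Context: $H$ is a separable real Hilbert space with norm $\|\cdot\|$ and Borel $\sigma$-algebra $\mathcal B_H$; $(\Omega,\mathcal F,\mathbb P)$ is a complete probability space with expectation $\mathsf E$; "a.s." means $\mathbb P$-almost surely. $\operatorname{Argmin}f$ is the set of minimizers of $f$. A random variable $y$ with values in $(K,\mathcal K)$ is a copy of $x$ if $\mathbb P([x\in S])=\mathbb P([y\in S])$ for every $S\in\mathcal K$. An operator $A\colon H\to H$ is demiregular at $\mathsf x\in H$ if, for every sequence $(\mathsf x_n)$ in $H$ such that $\mathsf x_n\rightharpoonup\mathsf x$ (weakly) and $A\mathsf x_n\to A\mathsf x$ (strongly), we have $\mathsf x_n\to\mathsf x$ strongly. $L^p(\Omega,\mathcal F,\mathbb P;H)$ is the space of (classes of a.s. equal) $H$-valued random variables with $\mathsf E\|x\|^p<+\infty$, with norm $(\mathsf E\|x\|^p)^{1/p}$; $L^p(\Omega,\mathcal F,\mathbb P;S)$ is the subset of those with values in the Borel set $S\subset H$ a.s. $\sigma(\cdot)$ is the generated $\sigma$-algebra. Weak (strong) convergence a.s. means weak (strong) convergence in $H$ of $(x_n(\omega))_n$ for $\mathbb P$-almost every $\omega$. *)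

theory Defs
  imports "HOL-Probability.Probability"
begin

(* A separable real Hilbert space is a type of sort
   {real_inner, banach, second_countable_topology}: for metric spaces, separability
   and second countability coincide, and this is the sort on which the Bochner
   integral of the library is defined. *)

text \<open>Meaningful where \<open>f\<close> is (Frechet) differentiable: on a Hilbert space the Riesz
  representation theorem then provides the vector, and it is unique.\<close>

definition gradient :: "('a::real_inner \<Rightarrow> real) \<Rightarrow> 'a \<Rightarrow> 'a"
  where "gradient f x = (THE D. GDERIV f x :> D)"

lemma gradient_eqI:
  assumes "GDERIV f x :> D"
  shows "gradient f x = D"
  unfolding gradient_def
proof (rule the_equality)
  show "GDERIV f x :> D" by (rule assms)
next
  fix D' assume "GDERIV f x :> D'"
  with assms have "(\<lambda>h. inner h D') = (\<lambda>h. inner h D)"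
    unfolding gderiv_def by (metis has_derivative_unique)
  then have "inner (D' - D) D' = inner (D' - D) D"
    by meson
  then show "D' = D"
    by (metis inner_diff_right inner_eq_zero_iff right_minus_eq)
qed

definition Argmin :: "('a \<Rightarrow> real) \<Rightarrow> 'a set"
  where "Argmin f = {x. is_arg_min f (\<lambda>_. True) x}"

definition weakly_converges :: "(nat \<Rightarrow> 'a::real_inner) \<Rightarrow> 'a \<Rightarrow> bool"
  where "weakly_converges u x \<longleftrightarrow> (\<forall>y. (\<lambda>n. inner (u n) y) \<longlonglongrightarrow> inner x y)"

definition demiregular_at :: "('a::real_inner \<Rightarrow> 'a) \<Rightarrow> 'a \<Rightarrow> bool"
  where "demiregular_at A x \<longleftrightarrow>
    (\<forall>u. weakly_converges u x \<longrightarrow> (\<lambda>n. A (u n)) \<longlonglongrightarrow> A x \<longrightarrow> u \<longlonglongrightarrow> x)"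

definition is_copy :: "'w measure \<Rightarrow> 'k measure \<Rightarrow> ('w \<Rightarrow> 'k) \<Rightarrow> ('w \<Rightarrow> 'k) \<Rightarrow> bool"
  where "is_copy M K y x \<longleftrightarrow> y \<in> measurable M K \<and> x \<in> measurable M K \<and>
    (\<forall>S\<in>sets K. measure M {\<omega> \<in> space M. x \<omega> \<in> S} = measure M {\<omega> \<in> space M. y \<omega> \<in> S})"

text \<open>The \<open>\<sigma>\<close>-algebra \<open>\<sigma>(x\<^sub>0, \<dots>, x\<^sub>n)\<close>.\<close>

definition sigma_upto :: "'w measure \<Rightarrow> (nat \<Rightarrow> 'w \<Rightarrow> 'a::topological_space) \<Rightarrow> nat \<Rightarrow> 'w set set"
  where "sigma_upto M x n =
    sigma_sets (space M) (\<Union>i\<le>n. {x i -` B \<inter> space M | B. B \<in> sets borel})"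

definition indep_of :: "'w measure \<Rightarrow> 'k measure \<Rightarrow> ('w \<Rightarrow> 'k) \<Rightarrow> 'w set set \<Rightarrow> bool"
  where "indep_of M K k \<X> \<longleftrightarrow> prob_space.indep_set M (sets (vimage_algebra (space M) k K)) \<X>"

text \<open>Elements of \<open>L\<^sup>p\<close> are represented by functions; identification of a.s. equal functions is
  left implicit, all notions below being invariant under it on a complete probability space.\<close>

definition in_Lp :: "real \<Rightarrow> 'w measure \<Rightarrow> ('w \<Rightarrow> 'a::real_normed_vector) \<Rightarrow> bool"
  where "in_Lp p M x \<longleftrightarrow> x \<in> borel_measurable M \<and> integrable M (\<lambda>\<omega>. norm (x \<omega>) powr p)"

definition in_Lp_on :: "real \<Rightarrow> 'w measure \<Rightarrow> 'a set \<Rightarrow> ('w \<Rightarrow> 'a::real_normed_vector) \<Rightarrow> bool"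
  where "in_Lp_on p M S x \<longleftrightarrow> in_Lp p M x \<and> (AE \<omega> in M. x \<omega> \<in> S)"

definition Lp_norm :: "real \<Rightarrow> 'w measure \<Rightarrow> ('w \<Rightarrow> 'a::real_normed_vector) \<Rightarrow> real"
  where "Lp_norm p M x = (\<integral>\<omega>. norm (x \<omega>) powr p \<partial>M) powr (1 / p)"

definition strongly_converges_Lp ::
    "real \<Rightarrow> 'w measure \<Rightarrow> (nat \<Rightarrow> 'w \<Rightarrow> 'a::real_normed_vector) \<Rightarrow> ('w \<Rightarrow> 'a) \<Rightarrow> bool"
  where "strongly_converges_Lp p M u x \<longleftrightarrow> (\<forall>n. in_Lp p M (u n)) \<and> in_Lp p M x \<and>
    (\<lambda>n. Lp_norm p M (\<lambda>\<omega>. u n \<omega> - x \<omega>)) \<longlonglongrightarrow> 0"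

text \<open>Weak convergence in the Hilbert space \<open>L\<^sup>2\<close>, whose scalar product is
  \<open>(x, y) \<mapsto> E (inner x y)\<close>.\<close>

definition weakly_converges_L2 ::
    "'w measure \<Rightarrow> (nat \<Rightarrow> 'w \<Rightarrow> 'a::real_inner) \<Rightarrow> ('w \<Rightarrow> 'a) \<Rightarrow> bool"
  where "weakly_converges_L2 M u x \<longleftrightarrow> (\<forall>n. in_Lp 2 M (u n)) \<and> in_Lp 2 M x \<and>
    (\<forall>y. in_Lp 2 M y \<longrightarrow>
      (\<lambda>n. \<integral>\<omega>. inner (u n \<omega>) (y \<omega>) \<partial>M) \<longlonglongrightarrow> (\<integral>\<omega>. inner (x \<omega>) (y \<omega>) \<partial>M))"

definition strongly_converges_as ::
    "'w measure \<Rightarrow> (nat \<Rightarrow> 'w \<Rightarrow> 'a::topological_space) \<Rightarrow> ('w \<Rightarrow> 'a) \<Rightarrow> bool"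
  where "strongly_converges_as M u x \<longleftrightarrow> (AE \<omega> in M. (\<lambda>n. u n \<omega>) \<longlonglongrightarrow> x \<omega>)"

definition weakly_converges_as ::
    "'w measure \<Rightarrow> (nat \<Rightarrow> 'w \<Rightarrow> 'a::real_inner) \<Rightarrow> ('w \<Rightarrow> 'a) \<Rightarrow> bool"
  where "weakly_converges_as M u x \<longleftrightarrow> (AE \<omega> in M. weakly_converges (\<lambda>n. u n \<omega>) (x \<omega>))"

end

theory Submission
  imports Defs "HOL-Complex_Analysis.Great_Picard"
begin

text \<open>
Write \<open>A\<close> for the gradient of \<open>f\<close>. The recursion is a gradient descent disturbed by noise,
\<open>x\<^sub>n\<^sub>+\<^sub>1 = x\<^sub>n - \<gamma>\<^sub>n A(x\<^sub>n) - V\<^sub>n\<close>, where almost surely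
\<open>V\<^sub>n = \<gamma>\<^sub>n (\<nabla>g(k\<^sub>n, x\<^sub>n) - A(x\<^sub>n))\<close>. As \<open>k\<^sub>n\<close> is independent of the past and distributed
like \<open>k\<close>, the past may be frozen when averaging over \<open>k\<^sub>n\<close>; hence the \<open>V\<^sub>n\<close> are martingale
differences in \<open>L\<^sup>2\<close> with \<open>E\<parallel>V\<^sub>n\<parallel>\<^sup>2 \<le> \<xi> \<gamma>\<^sub>n\<^sup>2\<close>, a summable sequence. Kolmogorov's maximal inequality
makes \<open>S\<^sub>n = V\<^sub>0 + \<dots> + V\<^sub>n\<^sub>-\<^sub>1\<close> converge almost surely to some \<open>S\<close>, and
\<open>E\<parallel>S - S\<^sub>n\<parallel>\<^sup>2 \<le> \<xi> \<Sum>\<^sub>i\<^sub>\<ge>\<^sub>n \<gamma>\<^sub>i\<^sup>2\<close>. The almost sure statements are now settled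
path by path.

Put \<open>e\<^sub>n = S - S\<^sub>n\<close> and \<open>y\<^sub>n = x\<^sub>n - e\<^sub>n\<close>. The noise cancels: \<open>y\<^sub>n\<^sub>+\<^sub>1 = y\<^sub>n - \<gamma>\<^sub>n A(y\<^sub>n + e\<^sub>n)\<close>, a gradient
descent whose gradient is evaluated at a slightly wrong point. Its errors are harmless if
\<open>\<Sum> \<gamma>\<^sub>n \<parallel>e\<^sub>n\<parallel>\<^sup>2 < \<infinity>\<close>, and this holds almost surely because
\<open>\<Sum>\<^sub>n \<gamma>\<^sub>n \<Sum>\<^sub>i\<^sub>\<ge>\<^sub>n \<gamma>\<^sub>i\<^sup>2 < \<infinity>\<close>, which is where \<open>\<nu> > 2/3\<close> enters (\<open>step_remainder_summable\<close>).
Cocoercivity of \<open>A\<close> then makes \<open>\<parallel>y\<^sub>n - z\<parallel>\<close> converge for every minimizer \<open>z\<close> and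
\<open>\<Sum> \<gamma>\<^sub>n \<parallel>A(x\<^sub>n)\<parallel>\<^sup>2\<close> finite, while the descent inequality makes \<open>f(y\<^sub>n)\<close> converge. Since
\<open>\<Sum> \<gamma>\<^sub>n = \<infinity>\<close>, which is where \<open>\<nu> \<le> 1\<close> enters, the limit of \<open>f(y\<^sub>n)\<close> can only be the minimum.
So \<open>A(x\<^sub>n)\<close> tends to \<open>0\<close>, weak cluster points are minimizers, and Opial's argument yields one
weak limit (\<open>perturbed_gradient_descent\<close>). Demiregularity turns this into strong convergence.

For the statements in the mean, \<open>E\<parallel>x\<^sub>n - z\<parallel>\<^sup>2\<close> is bounded, because a gradient step with
\<open>\<gamma>\<^sub>n \<le> 2\<beta>\<close> does not move away from \<open>z\<close> and the noise is orthogonal to the past. A sequence that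
is bounded in \<open>L\<^sup>2\<close> and converges almost surely converges in \<open>L\<^sup>1\<close>, and a variant of this fact
(\<open>integral_norm_tendsto_0\<close>) also gives weak convergence in \<open>L\<^sup>2\<close>.
\<close>

section \<open>Riesz representation and weak convergence\<close>

text \<open>The representing vector is the minimizer of \<open>\<phi>(y) = \<parallel>y\<parallel>\<^sup>2 - 2 L(y)\<close>: by the parallelogram
  identity minimizing sequences are Cauchy, and at a minimizer the derivative
  \<open>2 (inner p y - L y)\<close> of \<open>\<phi>\<close> in the direction \<open>y\<close> vanishes.\<close>

lemma riesz_representation:
  fixes L :: "'a::{real_inner, banach} \<Rightarrow> real"
  assumes "bounded_linear L"
  shows "\<exists>p. \<forall>y. L y = inner y p"
proof -
  interpret L: bounded_linear L by fact
  obtain B where B: "\<And>y. norm (L y) \<le> norm y * B"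
    using L.bounded by blast
  define \<phi> where "\<phi> y = (norm y)\<^sup>2 - 2 * L y" for y
  define m where "m = Inf (range \<phi>)"
  have below: "\<phi> y \<ge> - B\<^sup>2" for y
  proof -
    have "2 * L y \<le> 2 * (norm y * B)" using B[of y] by simp
    moreover have "0 \<le> (norm y - B)\<^sup>2" by simp
    ultimately show ?thesis
      unfolding \<phi>_def by (simp add: power2_diff)
  qed
  then have bdd: "bdd_below (range \<phi>)" by (meson bdd_belowI2)
  have m_le: "m \<le> \<phi> y" for y
    unfolding m_def by (rule cInf_lower[OF _ bdd]) simp
  have "\<exists>v. \<phi> v < m + 1 / (real n + 1)" for n
    using cInf_lessD[of "range \<phi>" "m + 1 / (real n + 1)"] unfolding m_def[symmetric] by auto
  then obtain v where v: "\<And>n. \<phi> (v n) < m + 1 / (real n + 1)" by metis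
  have parallelogram: "(norm (a - b))\<^sup>2 \<le> 2 * (\<phi> a - m) + 2 * (\<phi> b - m)" for a b
  proof -
    have "(norm (a - b))\<^sup>2 = 2 * \<phi> a + 2 * \<phi> b - 4 * \<phi> ((1/2) *\<^sub>R (a + b))"
      unfolding \<phi>_def power2_norm_eq_inner
      by (simp add: L.add L.scaleR algebra_simps inner_commute)
    then show ?thesis using m_le[of "(1/2) *\<^sub>R (a + b)"] by simp
  qed
  have "Cauchy v"
  proof (rule CauchyI)
    fix e :: real assume e: "0 < e"
    obtain N where N: "4 / e\<^sup>2 < real N" using reals_Archimedean2 by blast
    have "norm (v i - v j) < e" if "i \<ge> N" "j \<ge> N" for i j
    proof -
      have inv: "1 / (real n + 1) < e\<^sup>2 / 4" if "n \<ge> N" for n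
      proof -
        have "4 / e\<^sup>2 < real n + 1" using N that by linarith
        then show ?thesis using e by (simp add: field_simps)
      qed
      have near: "\<phi> (v n) < m + e\<^sup>2 / 4" if "n \<ge> N" for n
        using less_trans[OF v[of n] add_strict_left_mono[OF inv[OF that]]] .
      note parallelogram[of "v i" "v j"]
      also have "2 * (\<phi> (v i) - m) + 2 * (\<phi> (v j) - m) < e\<^sup>2"
        using near[OF that(1)] near[OF that(2)] by simp
      finally have "(norm (v i - v j))\<^sup>2 < e\<^sup>2" .
      then show ?thesis using e power_less_imp_less_base by fastforce
    qed
    then show "\<exists>N. \<forall>i\<ge>N. \<forall>j\<ge>N. norm (v i - v j) < e" by blast
  qed
  then obtain p where p: "v \<longlonglongrightarrow> p" using Cauchy_convergent_iff convergent_def by blast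
  have "(\<lambda>n. \<phi> (v n)) \<longlonglongrightarrow> \<phi> p"
    unfolding \<phi>_def by (intro tendsto_intros L.tendsto p)
  moreover have "(\<lambda>n. m + 1 / (real n + 1)) \<longlonglongrightarrow> m + 0"
    using LIMSEQ_Suc[OF lim_1_over_n[where 'a=real]] by (intro tendsto_intros) (simp add: add.commute)
  ultimately have "\<phi> p \<le> m"
    using v by (intro LIMSEQ_le[of "\<lambda>n. \<phi> (v n)" _ "\<lambda>n. m + 1 / (real n + 1)"]) (auto intro: less_imp_le)
  have "L y = inner y p" for y
  proof -
    define c N where "c = inner p y - L y" and "N = (norm y)\<^sup>2 + 1"
    \<comment> \<open>Any \<open>t\<close> of the sign of \<open>- c\<close> and small enough would do: the linear term of \<open>\<phi> (p + t y)\<close> then dominates.\<close>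
    define t where "t = - c / N"
    have N: "N \<ge> 1" unfolding N_def by simp
    have "\<phi> p \<le> \<phi> (p + t *\<^sub>R y)" using \<open>\<phi> p \<le> m\<close> m_le order.trans by blast
    also have "\<phi> (p + t *\<^sub>R y) = \<phi> p + 2 * t * c + t\<^sup>2 * (N - 1)"
      unfolding \<phi>_def c_def N_def power2_norm_eq_inner
      by (simp add: L.add L.scaleR algebra_simps inner_commute power2_eq_square)
    finally have "0 \<le> 2 * t * c + t\<^sup>2 * (N - 1)" by simp
    also have "\<dots> = - (c\<^sup>2 * ((N + 1) / N\<^sup>2))"
      using N unfolding t_def by (simp add: field_simps power2_eq_square)
    finally have "c\<^sup>2 * ((N + 1) / N\<^sup>2) \<le> 0" by simp
    moreover have "(N + 1) / N\<^sup>2 > 0" using N by simp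
    ultimately have "c\<^sup>2 \<le> 0" by (metis mult_le_0_iff not_le)
    then have "c = 0" by simp
    then show ?thesis unfolding c_def by (simp add: inner_commute)
  qed
  then show ?thesis by blast
qed

text \<open>Differentiability provides a bounded linear functional only; Riesz turns it into a vector.\<close>

lemma GDERIV_gradient:
  fixes f :: "'a::{real_inner, banach} \<Rightarrow> real"
  assumes "f differentiable (at z)"
  shows "GDERIV f z :> gradient f z"
proof -
  obtain L where L: "(f has_derivative L) (at z)"
    using assms unfolding differentiable_def by blast
  then obtain p where "\<forall>y. L y = inner y p"
    using riesz_representation has_derivative_bounded_linear by blast
  then have "L = (\<lambda>y. inner y p)" by auto
  then have "GDERIV f z :> p" using L unfolding gderiv_def by simp
  then show ?thesis using gradient_eqI[of f z p] by simp
qed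

text \<open>A diagonal subsequence converges when tested against a countable dense set, hence, by
  boundedness, against every vector; the limit functional is bounded and so is a vector.\<close>

lemma bounded_weakly_convergent_subsequence:
  fixes u :: "nat \<Rightarrow> 'a::{real_inner, banach, second_countable_topology}"
  assumes bd: "\<And>n. norm (u n) \<le> R"
  shows "\<exists>r p. strict_mono r \<and> weakly_converges (u \<circ> r) p"
proof -
  have R: "R \<ge> 0" using bd[of 0] norm_ge_zero order.trans by blast
  obtain D :: "'a set" where D: "countable D" "\<And>U. open U \<Longrightarrow> U \<noteq> {} \<Longrightarrow> \<exists>d\<in>D. d \<in> U"
    by (rule countable_dense_setE) blast
  \<comment> \<open>Dividing by \<open>norm d + 1\<close> makes the bound uniform in \<open>d\<close>, as the diagonal argument requires.\<close>
  have "norm (inner (u n) d / (norm d + 1)) \<le> R" for n d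
  proof -
    have pos: "0 < norm d + 1" using norm_ge_zero[of d] by linarith
    have "\<bar>inner (u n) d\<bar> \<le> norm (u n) * norm d" by (rule Cauchy_Schwarz_ineq2)
    also have "\<dots> \<le> R * (norm d + 1)" using bd[of n] R by (intro mult_mono) auto
    finally show ?thesis using pos by (simp only: real_norm_def abs_divide pos_divide_le_eq abs_of_pos)
  qed
  then obtain r :: "nat \<Rightarrow> nat" where r: "strict_mono r"
    and conv: "\<And>d. d \<in> D \<Longrightarrow> \<exists>l. (\<lambda>n. inner (u (r n)) d / (norm d + 1)) \<longlonglongrightarrow> l"
    using function_convergent_subsequence[OF D(1), of "\<lambda>n d. inner (u n) d / (norm d + 1)" R]
    by blast
  have convD: "convergent (\<lambda>n. inner (u (r n)) d)" if d: "d \<in> D" for d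
  proof -
    have "norm d + 1 \<noteq> 0" using norm_ge_zero[of d] by linarith
    then have eq: "(norm d + 1) * (inner (u (r n)) d / (norm d + 1)) = inner (u (r n)) d" for n by simp
    show ?thesis
      using convergent_mult[OF convergent_const[of "norm d + 1"] conv[OF d, folded convergent_def]] unfolding eq .
  qed
  have conv: "convergent (\<lambda>n. inner (u (r n)) y)" for y
  proof -
    have "Cauchy (\<lambda>n. inner (u (r n)) y)"
    proof (rule CauchyI)
      fix e :: real assume e: "0 < e"
      have "0 < e / (4 * (R + 1))" using e R by simp
      then have "\<exists>d\<in>D. d \<in> ball y (e / (4 * (R + 1)))"
        by (intro D(2)) (auto simp del: zero_less_divide_iff)
      then obtain d where d: "d \<in> D" "norm (y - d) < e / (4 * (R + 1))"
        by (auto simp: dist_norm)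
      have near: "\<bar>inner (u n) y - inner (u n) d\<bar> \<le> e / 4" for n
      proof -
        have "\<bar>inner (u n) (y - d)\<bar> \<le> norm (u n) * norm (y - d)" by (rule Cauchy_Schwarz_ineq2)
        also have "\<dots> \<le> (R + 1) * (e / (4 * (R + 1)))" using bd[of n] d(2) R e
          by (intro mult_mono) auto
        also have "\<dots> = e / 4" using R nonzero_mult_divide_mult_cancel_left[of "R + 1" e 4]
          by (simp add: mult.commute[of 4])
        finally show ?thesis by (simp add: inner_diff_right)
      qed
      obtain N where N: "\<And>i j. i \<ge> N \<Longrightarrow> j \<ge> N \<Longrightarrow> norm (inner (u (r i)) d - inner (u (r j)) d) < e / 4"
        using CauchyD[OF convergent_Cauchy[OF convD[OF d(1)]], of "e / 4"] e by auto
      have "norm (inner (u (r i)) y - inner (u (r j)) y) < e" if "i \<ge> N" "j \<ge> N" for i j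
        using N[OF that] near[of "r i"] near[of "r j"] e unfolding real_norm_def by linarith
      then show "\<exists>N. \<forall>i\<ge>N. \<forall>j\<ge>N. norm (inner (u (r i)) y - inner (u (r j)) y) < e" by blast
    qed
    then show ?thesis by (simp add: Cauchy_convergent_iff)
  qed
  define L where "L y = lim (\<lambda>n. inner (u (r n)) y)" for y
  have L: "(\<lambda>n. inner (u (r n)) y) \<longlonglongrightarrow> L y" for y
    unfolding L_def using conv convergent_LIMSEQ_iff by blast
  have "bounded_linear L"
  proof (rule bounded_linear_intro[where K = R])
    show "L (x + y) = L x + L y" for x y
      by (rule LIMSEQ_unique[OF L]) (simp add: inner_add_right tendsto_add L)
    show "L (c *\<^sub>R x) = c *\<^sub>R L x" for c x
      by (rule LIMSEQ_unique[OF L]) (simp add: tendsto_mult L)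
    show "norm (L x) \<le> norm x * R" for x
    proof (rule LIMSEQ_le_const2[OF tendsto_norm[OF L]], intro exI allI impI)
      fix n
      have "\<bar>inner (u (r n)) x\<bar> \<le> norm (u (r n)) * norm x" by (rule Cauchy_Schwarz_ineq2)
      also have "\<dots> \<le> R * norm x" using bd by (intro mult_right_mono) auto
      finally show "norm (inner (u (r n)) x) \<le> norm x * R" by (simp add: mult.commute)
    qed
  qed
  then obtain p where "\<forall>y. L y = inner y p" using riesz_representation by blast
  then have "weakly_converges (u \<circ> r) p"
    unfolding weakly_converges_def using L by (simp add: inner_commute)
  then show ?thesis using r by blast
qed

text \<open>Two weak cluster points \<open>p\<close>, \<open>q\<close> in \<open>Z\<close> coincide: by polarization
  \<open>\<parallel>y\<^sub>n - q\<parallel>\<^sup>2 - \<parallel>y\<^sub>n - p\<parallel>\<^sup>2\<close> is affine in \<open>inner (y\<^sub>n) (p - q)\<close>, so the latter converges, and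
  its limits along the two subsequences are \<open>inner p (p - q)\<close> and \<open>inner q (p - q)\<close>.\<close>

lemma opial:
  fixes y :: "nat \<Rightarrow> 'a::{real_inner, banach, second_countable_topology}"
  assumes ne: "Z \<noteq> {}"
    and dist_conv: "\<And>z. z \<in> Z \<Longrightarrow> convergent (\<lambda>n. norm (y n - z))"
    and cluster: "\<And>r p. strict_mono r \<Longrightarrow> weakly_converges (y \<circ> r) p \<Longrightarrow> p \<in> Z"
  shows "\<exists>p\<in>Z. weakly_converges y p"
proof -
  obtain z where z: "z \<in> Z" using ne by blast
  obtain R where R: "\<And>n. norm (y n - z) \<le> R"
    using convergent_imp_Bseq[OF dist_conv[OF z]] by (auto simp: Bseq_def)
  have bd: "norm (y n) \<le> R + norm z" for n
    using R[of n] norm_triangle_sub[of "y n" z] by linarith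
  obtain r p where r: "strict_mono r" and p: "weakly_converges (y \<circ> r) p"
    using bounded_weakly_convergent_subsequence[of y, OF bd] by blast
  have unique: "q = p" if r': "strict_mono r'" and q: "weakly_converges (y \<circ> r') q" for r' q
  proof -
    have pq: "p \<in> Z" "q \<in> Z" using cluster r p r' q by auto
    have eq: "inner (y n) (p - q) =
       ((norm (y n - q))\<^sup>2 - (norm (y n - p))\<^sup>2 + (norm p)\<^sup>2 - (norm q)\<^sup>2) / 2" for n
      unfolding power2_norm_eq_inner by (simp add: algebra_simps inner_commute)
    obtain a b where "(\<lambda>n. norm (y n - p)) \<longlonglongrightarrow> a" "(\<lambda>n. norm (y n - q)) \<longlonglongrightarrow> b"
      using dist_conv pq unfolding convergent_def by blast
    then have "(\<lambda>n. inner (y n) (p - q)) \<longlonglongrightarrow> (b\<^sup>2 - a\<^sup>2 + (norm p)\<^sup>2 - (norm q)\<^sup>2) / 2"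
      unfolding eq by (intro tendsto_intros) auto
    from LIMSEQ_subseq_LIMSEQ[OF this r] LIMSEQ_subseq_LIMSEQ[OF this r']
    have lim: "(\<lambda>n. inner (y (r n)) (p - q)) \<longlonglongrightarrow> (b\<^sup>2 - a\<^sup>2 + (norm p)\<^sup>2 - (norm q)\<^sup>2) / 2"
      "(\<lambda>n. inner (y (r' n)) (p - q)) \<longlonglongrightarrow> (b\<^sup>2 - a\<^sup>2 + (norm p)\<^sup>2 - (norm q)\<^sup>2) / 2"
      by (simp_all add: o_def)
    have "(\<lambda>n. inner (y (r n)) (p - q)) \<longlonglongrightarrow> inner p (p - q)"
      "(\<lambda>n. inner (y (r' n)) (p - q)) \<longlonglongrightarrow> inner q (p - q)"
      using p q unfolding weakly_converges_def by (simp_all add: o_def)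
    then have "inner p (p - q) = inner q (p - q)"
      using LIMSEQ_unique[OF lim(1)] LIMSEQ_unique[OF lim(2)] by simp
    then have "inner (p - q) (p - q) = 0" by (simp add: inner_diff_left)
    then show ?thesis by simp
  qed
  have "weakly_converges y p"
    unfolding weakly_converges_def
  proof
    fix h
    show "(\<lambda>n. inner (y n) h) \<longlonglongrightarrow> inner p h"
    proof (rule ccontr)
      assume "\<not> ?thesis"
      then obtain e where e: "e > 0" "\<exists>\<^sub>F n in sequentially. \<not> dist (inner (y n) h) (inner p h) < e"
        unfolding tendsto_iff by (auto simp: not_eventually)
      then have inf: "infinite {n. \<not> dist (inner (y n) h) (inner p h) < e}"
        by (simp add: frequently_cofinite cofinite_eq_sequentially[symmetric])
      define s where "s = enumerate {n. \<not> dist (inner (y n) h) (inner p h) < e}"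
      have s: "strict_mono s" unfolding s_def using inf by (rule strict_mono_enumerate)
      have far: "\<not> dist (inner (y (s n)) h) (inner p h) < e" for n
        using enumerate_in_set[OF inf, of n] unfolding s_def by simp
      obtain r' q where r': "strict_mono r'" and q: "weakly_converges (y \<circ> s \<circ> r') q"
        using bounded_weakly_convergent_subsequence[of "y \<circ> s" "R + norm z"] bd by (auto simp: o_def)
      have "q = p" using q by (intro unique[OF strict_mono_o[OF s r']]) (simp add: o_assoc)
      then have "(\<lambda>n. inner (y (s (r' n))) h) \<longlonglongrightarrow> inner p h"
        using q unfolding weakly_converges_def by simp
      then have "\<forall>\<^sub>F n in sequentially. dist (inner (y (s (r' n))) h) (inner p h) < e"
        using e(1) by (rule tendstoD)
      then show False using far by simp
    qed
  qed
  moreover have "p \<in> Z" using cluster r p by blast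
  ultimately show ?thesis by blast
qed

section \<open>Smooth convex functions and perturbed gradient descent\<close>

lemma has_real_derivative_along_line:
  fixes f :: "'a::{real_inner, banach} \<Rightarrow> real"
  assumes "\<And>z. f differentiable (at z)"
  shows "((\<lambda>t. f (x + t *\<^sub>R d)) has_real_derivative inner d (gradient f (x + t *\<^sub>R d))) (at t)"
proof -
  have f': "(f has_derivative (\<lambda>h. inner h (gradient f (x + t *\<^sub>R d)))) (at (x + t *\<^sub>R d))"
    using GDERIV_gradient[OF assms] unfolding gderiv_def .
  have "((\<lambda>t. x + t *\<^sub>R d) has_derivative (\<lambda>h. h *\<^sub>R d)) (at t)"
    by (auto intro!: derivative_eq_intros)
  from has_derivative_compose[OF this f'] show ?thesis
    by (simp add: has_field_derivative_def mult_commute_abs)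
qed

locale smooth_convex =
  fixes f :: "'a::{real_inner, banach, second_countable_topology} \<Rightarrow> real" and \<beta> :: real
  assumes beta: "\<beta> > 0"
    and f_convex: "convex_on UNIV f"
    and f_diff: "\<And>z. f differentiable (at z)"
    and f_lip: "(1 / \<beta>)-lipschitz_on UNIV (gradient f)"
begin

abbreviation A :: "'a \<Rightarrow> 'a" where "A \<equiv> gradient f"

lemma grad_lipschitz: "norm (A x - A y) \<le> norm (x - y) / \<beta>"
  using lipschitz_onD[OF f_lip, of x y] by (simp add: dist_norm)

lemma continuous_grad: "continuous_on UNIV A"
  using lipschitz_on_continuous_on[OF f_lip] .

lemma measurable_grad [measurable]: "A \<in> borel_measurable borel"
  by (rule borel_measurable_continuous_onI[OF continuous_grad])

text \<open>Convexity along the segment from \<open>x\<close> to \<open>y\<close> reduces this to functions of one real variable.\<close>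

lemma tangent_below: "f x + inner (A x) (y - x) \<le> f y"
proof -
  have conv: "convex_on UNIV (\<lambda>t. f (x + t *\<^sub>R (y - x)))"
  proof (rule convex_onI)
    fix t a b :: real assume "0 < t" "t < 1"
    have "x + ((1 - t) *\<^sub>R a + t *\<^sub>R b) *\<^sub>R (y - x) =
          (1 - t) *\<^sub>R (x + a *\<^sub>R (y - x)) + t *\<^sub>R (x + b *\<^sub>R (y - x))"
      by (simp add: algebra_simps)
    then show "f (x + ((1 - t) *\<^sub>R a + t *\<^sub>R b) *\<^sub>R (y - x)) \<le>
        (1 - t) * f (x + a *\<^sub>R (y - x)) + t * f (x + b *\<^sub>R (y - x))"
      using convex_onD[OF f_convex, of t] \<open>0 < t\<close> \<open>t < 1\<close> by simp
  qed simp
  have "f (x + 1 *\<^sub>R (y - x)) - f (x + 0 *\<^sub>R (y - x)) \<ge> inner (y - x) (A (x + 0 *\<^sub>R (y - x))) * (1 - 0)"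
    using has_real_derivative_along_line[OF f_diff, of x "y - x" 0]
    by (intro convex_on_imp_above_tangent[OF conv]) auto
  then show ?thesis by (simp add: inner_commute)
qed

text \<open>The upper quadratic bound: along the segment, the Lipschitz condition bounds the growth of
  the derivative.\<close>

lemma descent: "f y \<le> f x + inner (A x) (y - x) + (norm (y - x))\<^sup>2 / (2 * \<beta>)"
proof -
  define d where "d = y - x"
  define \<psi> where "\<psi> t = f (x + t *\<^sub>R d) - t * inner (A x) d - t\<^sup>2 * ((norm d)\<^sup>2 / (2 * \<beta>))" for t :: real
  have der: "(\<psi> has_real_derivative (inner d (A (x + t *\<^sub>R d)) - inner (A x) d - 2 * t * ((norm d)\<^sup>2 / (2 * \<beta>)))) (at t)" for t
    unfolding \<psi>_def using beta by (auto intro!: derivative_eq_intros has_real_derivative_along_line f_diff)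
  have "\<psi> 1 \<le> \<psi> 0"
  proof (rule DERIV_nonpos_imp_nonincreasing[of 0 1])
    fix t :: real assume t: "0 \<le> t" "t \<le> 1"
    have "inner d (A (x + t *\<^sub>R d)) - inner (A x) d = inner d (A (x + t *\<^sub>R d) - A x)"
      by (simp add: inner_diff_right inner_commute)
    also have "\<dots> \<le> norm d * norm (A (x + t *\<^sub>R d) - A x)" by (rule norm_cauchy_schwarz)
    also have "\<dots> \<le> norm d * (norm (x + t *\<^sub>R d - x) / \<beta>)"
      by (intro mult_left_mono grad_lipschitz) simp
    also have "\<dots> = 2 * t * ((norm d)\<^sup>2 / (2 * \<beta>))"
      using t by (simp add: power2_eq_square)
    finally show "\<exists>y. DERIV \<psi> t :> y \<and> y \<le> 0" using der[of t] by fastforce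
  qed simp
  then show ?thesis unfolding \<psi>_def d_def by simp
qed

text \<open>The function \<open>f - inner (A x)\<close> is minimal at \<open>x\<close>. One gradient step of length \<open>\<beta>\<close> from \<open>y\<close>
  lowers it by at least \<open>\<beta>/2\<close> times its squared gradient at \<open>y\<close>, without passing below that minimum.\<close>

lemma tangent_below_strong:
  "f x + inner (A x) (y - x) + \<beta> / 2 * (norm (A y - A x))\<^sup>2 \<le> f y"
proof -
  define D where "D = A y - A x"
  define w where "w = y - \<beta> *\<^sub>R D"
  have "f x + inner (A x) (w - x) \<le> f w" by (rule tangent_below)
  also have "f w \<le> f y + inner (A y) (w - y) + (norm (w - y))\<^sup>2 / (2 * \<beta>)" by (rule descent)
  also have "(norm (w - y))\<^sup>2 = (\<beta> * norm D)\<^sup>2" unfolding w_def by (simp add: power_mult_distrib)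
  finally have chain: "f x + inner (A x) (w - x) \<le> f y + inner (A y) (w - y) + (\<beta> * norm D)\<^sup>2 / (2 * \<beta>)" .
  have "f x + inner (A x) (y - x) + \<beta> * inner D D - (\<beta> * norm D)\<^sup>2 / (2 * \<beta>) \<le> f y"
  proof -
    have "inner (A x) (w - x) = inner (A x) (y - x) - \<beta> * inner (A x) D"
      "inner (A y) (w - y) = - (\<beta> * inner (A y) D)"
      unfolding w_def by (simp_all add: inner_diff_right)
    moreover have "\<beta> * inner D D = \<beta> * inner (A y) D - \<beta> * inner (A x) D"
      unfolding D_def by (simp add: inner_diff_left right_diff_distrib)
    ultimately show ?thesis using chain by linarith
  qed
  moreover have "(\<beta> * norm D)\<^sup>2 / (2 * \<beta>) = \<beta> / 2 * inner D D"
    using beta by (simp add: power2_eq_square power2_norm_eq_inner[symmetric])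
  ultimately show ?thesis
    unfolding D_def[symmetric] power2_norm_eq_inner by simp
qed

text \<open>The theorem of Baillon and Haddad: add the previous inequality to itself with \<open>x\<close> and \<open>y\<close>
  exchanged.\<close>

lemma cocoercive: "\<beta> * (norm (A x - A y))\<^sup>2 \<le> inner (A x - A y) (x - y)"
  using tangent_below_strong[of x y] tangent_below_strong[of y x]
  by (simp add: inner_diff_left inner_diff_right norm_minus_commute)

lemma Argmin_iff: "z \<in> Argmin f \<longleftrightarrow> A z = 0"
proof
  assume z: "z \<in> Argmin f"
  then have min: "f z \<le> f w" for w
    unfolding Argmin_def is_arg_min_linorder by simp
  have "f (z - \<beta> *\<^sub>R A z) \<le> f z + inner (A z) (- \<beta> *\<^sub>R A z) + (norm (\<beta> *\<^sub>R A z))\<^sup>2 / (2 * \<beta>)"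
    using descent[of "z - \<beta> *\<^sub>R A z" z] by simp
  also have "\<dots> = f z - \<beta> / 2 * (norm (A z))\<^sup>2"
    using beta by (simp add: power2_norm_eq_inner power_mult_distrib power2_eq_square[of \<beta>])
  finally have "\<beta> / 2 * (norm (A z))\<^sup>2 \<le> 0" using min[of "z - \<beta> *\<^sub>R A z"] by simp
  then show "A z = 0" using beta by (simp add: mult_le_0_iff)
next
  assume "A z = 0"
  then have "f z \<le> f w" for w using tangent_below[of z w] by simp
  then show "z \<in> Argmin f" unfolding Argmin_def is_arg_min_linorder by simp
qed

text \<open>For \<open>\<gamma> \<le> 2\<beta>\<close> a gradient step does not increase the distance to any minimizer.\<close>

lemma gradient_step_Fejer:
  assumes z: "z \<in> Argmin f" and "\<gamma> \<ge> 0"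
  shows "(norm (x - \<gamma> *\<^sub>R A x - z))\<^sup>2 \<le> (norm (x - z))\<^sup>2 - \<gamma> * (2 * \<beta> - \<gamma>) * (norm (A x))\<^sup>2"
proof -
  have "(norm (x - \<gamma> *\<^sub>R A x - z))\<^sup>2 = (norm (x - z))\<^sup>2 - 2 * \<gamma> * inner (A x) (x - z) + \<gamma>\<^sup>2 * (norm (A x))\<^sup>2"
    unfolding power2_norm_eq_inner by (simp add: algebra_simps inner_commute power2_eq_square)
  moreover have "\<gamma> * (\<beta> * (norm (A x))\<^sup>2) \<le> \<gamma> * inner (A x) (x - z)"
    using cocoercive[of x z] assms unfolding Argmin_iff by (intro mult_left_mono) auto
  ultimately show ?thesis by (simp add: algebra_simps power2_eq_square)
qed

end

text \<open>The corrected sequence \<open>d\<^sub>n + \<Sum>\<^sub>i\<^sub><\<^sub>n (b\<^sub>i - c\<^sub>i)\<close> is eventually decreasing and bounded below.\<close>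

lemma almost_decreasing_convergent:
  fixes d b c :: "nat \<Rightarrow> real"
  assumes step: "\<And>n. n \<ge> N \<Longrightarrow> d (Suc n) \<le> d n - b n + c n"
    and d: "\<And>n. d n \<ge> 0" and b: "\<And>n. b n \<ge> 0" and c: "\<And>n. c n \<ge> 0" and c_sum: "summable c"
  shows "convergent d" and "summable b"
proof -
  define C where "C = suminf c"
  have C: "(\<Sum>i<n. c i) \<le> C" for n
    unfolding C_def using c_sum c by (intro sum_le_suminf) auto
  define D where "D n = d n + (\<Sum>i<n. b i) - (\<Sum>i<n. c i)" for n
  have dec: "decseq (\<lambda>n. D (n + N))"
  proof (rule decseq_SucI)
    fix n
    show "D (Suc n + N) \<le> D (n + N)" using step[of "n + N"] unfolding D_def by simp
  qed
  have lower: "- C \<le> D n" for n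
  proof -
    have "0 \<le> (\<Sum>i<n. b i)" using b by (simp add: sum_nonneg)
    then show ?thesis using d[of n] C[of n] unfolding D_def by linarith
  qed
  have D_le: "D (n + N) \<le> D N" for n using decseqD[OF dec, of 0 n] by simp
  have bsum: "(\<Sum>i<n. b i) \<le> D N + C" for n
  proof -
    have "(\<Sum>i<n. b i) \<le> (\<Sum>i<n + N. b i)" using b by (intro sum_mono2) auto
    also have "\<dots> \<le> D (n + N) + C" using d[of "n + N"] C[of "n + N"] unfolding D_def by linarith
    finally show ?thesis using D_le[of n] by linarith
  qed
  show b_sum: "summable b"
    using b bsum by (rule summableI_nonneg_bounded)
  obtain l where "(\<lambda>n. D (n + N)) \<longlonglongrightarrow> l"
    using decseq_convergent[OF dec, of "- C"] lower by blast
  then have "D \<longlonglongrightarrow> l" by (rule LIMSEQ_offset)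
  then have "(\<lambda>n. D n - (\<Sum>i<n. b i) + (\<Sum>i<n. c i)) \<longlonglongrightarrow> l - suminf b + suminf c"
    by (intro tendsto_intros summable_LIMSEQ b_sum c_sum)
  moreover have "(\<lambda>n. D n - (\<Sum>i<n. b i) + (\<Sum>i<n. c i)) = d" unfolding D_def by auto
  ultimately show "convergent d" unfolding convergent_def by auto
qed

lemma limit_zero_if_weighted_summable:
  fixes g t :: "nat \<Rightarrow> real"
  assumes div: "\<not> summable g" and g: "\<And>n. g n \<ge> 0" and t: "\<And>n. t n \<ge> 0"
    and sum: "summable (\<lambda>n. g n * t n)" and lim: "t \<longlonglongrightarrow> l"
  shows "l = 0"
proof (rule ccontr)
  assume "l \<noteq> 0"
  moreover have "l \<ge> 0" using t by (intro LIMSEQ_le_const[OF lim]) auto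
  ultimately have l: "l > 0" by simp
  then have "\<forall>\<^sub>F n in sequentially. l / 2 < t n" using order_tendstoD(1)[OF lim, of "l / 2"] by simp
  then have "\<forall>\<^sub>F n in sequentially. norm (g n) \<le> 2 / l * (g n * t n)"
  proof eventually_elim
    case (elim n)
    then have "g n * (l / 2) \<le> g n * t n" using g by (intro mult_left_mono) auto
    then show ?case using l g[of n] by (simp add: field_simps)
  qed
  then have "summable g" by (rule summable_comparison_test_ev[OF _ summable_mult[OF sum]])
  then show False using div by simp
qed


text \<open>The deterministic core: \<open>u\<close> is one path of the iteration, \<open>s\<close> the accumulated noise. The
  auxiliary sequence \<open>y\<^sub>n = u\<^sub>n - (S - s\<^sub>n)\<close> performs noiseless steps with the gradient taken at \<open>u\<^sub>n\<close>
  instead of \<open>y\<^sub>n\<close>. In the Fejer and descent inequalities this replacement costs a multiple of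
  \<open>\<gamma>\<^sub>n \<parallel>S - s\<^sub>n\<parallel>\<^sup>2\<close>, a summable amount.\<close>

lemma (in smooth_convex) perturbed_gradient_descent:
  fixes u s :: "nat \<Rightarrow> 'a" and \<gamma> :: "nat \<Rightarrow> real"
  assumes ne: "Argmin f \<noteq> {}"
    and \<gamma>: "\<And>n. \<gamma> n \<ge> 0" "\<gamma> \<longlonglongrightarrow> 0" "\<not> summable \<gamma>"
    and step: "\<And>n. u (Suc n) + s (Suc n) = u n + s n - \<gamma> n *\<^sub>R A (u n)"
    and s: "s \<longlonglongrightarrow> S"
    and error: "summable (\<lambda>n. \<gamma> n * (norm (S - s n))\<^sup>2)"
  shows "(\<lambda>n. A (u n)) \<longlonglongrightarrow> 0" and "\<exists>p\<in>Argmin f. weakly_converges u p"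
proof -
  define e where "e n = S - s n" for n
  define y where "y n = u n - e n" for n
  define a where "a n = norm (A (u n))" for n
  have y_Suc: "y (Suc n) = y n - \<gamma> n *\<^sub>R A (u n)" for n
    using step[of n] unfolding y_def e_def by (simp add: algebra_simps)
  have e_lim: "e \<longlonglongrightarrow> 0"
    using tendsto_diff[OF tendsto_const[of S] s] unfolding e_def by simp
  have error: "summable (\<lambda>n. \<gamma> n * (norm (e n))\<^sup>2)" using error unfolding e_def .
  obtain N where N: "\<And>n. n \<ge> N \<Longrightarrow> \<gamma> n \<le> \<beta>"
    using order_tendstoD(2)[OF \<gamma>(2) beta] unfolding eventually_sequentially by (meson less_imp_le)
  have Ay: "norm (A (y n) - A (u n)) \<le> norm (e n) / \<beta>" for n
    using grad_lipschitz[of "y n" "u n"] unfolding y_def by simp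
  \<comment> \<open>By Young's inequality the error term is absorbed by half of the gain \<open>\<beta> \<gamma> n (a n)\<^sup>2\<close>.\<close>
  have Fejer: "(norm (y (Suc n) - z))\<^sup>2 \<le>
      (norm (y n - z))\<^sup>2 - \<beta> / 2 * (\<gamma> n * (a n)\<^sup>2) + 2 / \<beta> * (\<gamma> n * (norm (e n))\<^sup>2)"
    if z: "z \<in> Argmin f" and n: "n \<ge> N" for z n
  proof -
    have "\<beta> * (a n)\<^sup>2 \<le> inner (A (u n)) (u n - z)"
      using cocoercive[of "u n" z] z unfolding Argmin_iff a_def by simp
    moreover have "inner (A (u n)) (e n) \<le> \<beta> / 4 * (a n)\<^sup>2 + (norm (e n))\<^sup>2 / \<beta>"
    proof -
      have "inner (A (u n)) (e n) \<le> a n * norm (e n)" unfolding a_def by (rule norm_cauchy_schwarz)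
      also have "0 \<le> (\<beta> * a n - 2 * norm (e n))\<^sup>2 / (4 * \<beta>)" using beta by simp
      then have "a n * norm (e n) \<le> \<beta> / 4 * (a n)\<^sup>2 + (norm (e n))\<^sup>2 / \<beta>"
        using beta by (simp add: power2_diff power_mult_distrib field_simps power2_eq_square)
      finally show ?thesis .
    qed
    ultimately have "3 / 4 * \<beta> * (a n)\<^sup>2 - (norm (e n))\<^sup>2 / \<beta> \<le> inner (A (u n)) (y n - z)"
      unfolding y_def by (simp add: inner_diff_right)
    then have "\<gamma> n * (3 / 4 * \<beta> * (a n)\<^sup>2 - (norm (e n))\<^sup>2 / \<beta>) \<le> \<gamma> n * inner (A (u n)) (y n - z)"
      using \<gamma>(1) by (rule mult_left_mono)
    moreover have "\<gamma> n * \<gamma> n * (a n)\<^sup>2 \<le> \<gamma> n * \<beta> * (a n)\<^sup>2"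
      using N[OF n] \<gamma>(1) by (intro mult_right_mono mult_left_mono) auto
    moreover have "(norm (y (Suc n) - z))\<^sup>2 =
        (norm (y n - z))\<^sup>2 - 2 * (\<gamma> n * inner (A (u n)) (y n - z)) + \<gamma> n * \<gamma> n * (a n)\<^sup>2"
      unfolding y_Suc a_def power2_norm_eq_inner by (simp add: algebra_simps inner_commute)
    ultimately show ?thesis by (simp add: algebra_simps)
  qed
  note error_2 = summable_mult[OF error, of "2 / \<beta>"]
  have dist_conv: "convergent (\<lambda>n. norm (y n - z))" if z: "z \<in> Argmin f" for z
  proof -
    have "convergent (\<lambda>n. (norm (y n - z))\<^sup>2)"
      by (rule almost_decreasing_convergent(1)[OF Fejer[OF z] _ _ _ error_2]) (use beta \<gamma>(1) in auto)
    then obtain l where "(\<lambda>n. (norm (y n - z))\<^sup>2) \<longlonglongrightarrow> l" unfolding convergent_def by blast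
    from tendsto_real_sqrt[OF this] show ?thesis unfolding convergent_def by auto
  qed
  obtain z where z: "z \<in> Argmin f" using ne by blast
  have "summable (\<lambda>n. \<beta> / 2 * (\<gamma> n * (a n)\<^sup>2))"
    by (rule almost_decreasing_convergent(2)[OF Fejer[OF z] _ _ _ error_2]) (use beta \<gamma>(1) in auto)
  from summable_mult[OF this, of "2 / \<beta>"] have sum_a: "summable (\<lambda>n. \<gamma> n * (a n)\<^sup>2)"
    using beta by simp
  have min: "f z \<le> f w" for w
    using z unfolding Argmin_def is_arg_min_linorder by simp
  \<comment> \<open>The decrease \<open>\<gamma> n (a n)\<^sup>2 / 2\<close> pays for the second-order term, as \<open>\<gamma> n \<le> \<beta>\<close>.\<close>
  have f_step: "f (y (Suc n)) \<le> f (y n) + \<gamma> n * (norm (e n))\<^sup>2 / (2 * \<beta>\<^sup>2)" if n: "n \<ge> N" for n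
  proof -
    have "inner (A (u n) - A (y n)) (A (u n)) \<le> norm (A (u n) - A (y n)) * a n"
      unfolding a_def by (rule norm_cauchy_schwarz)
    also have "\<dots> \<le> norm (e n) / \<beta> * a n"
      using Ay[of n] unfolding a_def by (intro mult_right_mono) (auto simp: norm_minus_commute)
    also have "\<dots> \<le> (a n)\<^sup>2 / 2 + (norm (e n) / \<beta>)\<^sup>2 / 2"
      using sum_squares_bound[of "norm (e n) / \<beta>" "a n"] by simp
    finally have "(a n)\<^sup>2 / 2 - (norm (e n))\<^sup>2 / (2 * \<beta>\<^sup>2) \<le> inner (A (y n)) (A (u n))"
      unfolding a_def by (simp add: inner_diff_left power2_norm_eq_inner power_divide)
    then have "\<gamma> n * ((a n)\<^sup>2 / 2 - (norm (e n))\<^sup>2 / (2 * \<beta>\<^sup>2)) \<le> \<gamma> n * inner (A (y n)) (A (u n))"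
      using \<gamma>(1) by (rule mult_left_mono)
    moreover have "(norm (\<gamma> n *\<^sub>R A (u n)))\<^sup>2 / (2 * \<beta>) \<le> \<gamma> n * (a n)\<^sup>2 / 2"
    proof -
      have "\<gamma> n * \<gamma> n * (a n)\<^sup>2 \<le> \<gamma> n * \<beta> * (a n)\<^sup>2"
        using N[OF n] \<gamma>(1) by (intro mult_right_mono mult_left_mono) auto
      then show ?thesis using beta unfolding a_def
        by (simp add: power_mult_distrib power2_eq_square field_simps)
    qed
    ultimately show ?thesis
      using descent[of "y (Suc n)" "y n"] unfolding y_Suc by (simp add: algebra_simps)
  qed
  have "convergent (\<lambda>n. f (y n) - f z)"
  proof (rule almost_decreasing_convergent(1)[where b = "\<lambda>_. 0" and N = N])
    show "summable (\<lambda>n. 1 / (2 * \<beta>\<^sup>2) * (\<gamma> n * (norm (e n))\<^sup>2))"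
      by (rule summable_mult[OF error])
  qed (use f_step min \<gamma>(1) beta in auto)
  then obtain l where l: "(\<lambda>n. f (y n) - f z) \<longlonglongrightarrow> l" unfolding convergent_def by blast
  obtain R where R: "\<And>n. norm (y n - z) \<le> R"
    using convergent_imp_Bseq[OF dist_conv[OF z]] by (auto simp: Bseq_def)
  have gap: "f (y n) - f z \<le> R * norm (A (y n))" for n
  proof -
    have "f (y n) - f z \<le> inner (A (y n)) (y n - z)"
      using tangent_below[of "y n" z] by (simp add: inner_diff_right)
    also have "\<dots> \<le> norm (A (y n)) * norm (y n - z)" by (rule norm_cauchy_schwarz)
    also have "\<dots> \<le> R * norm (A (y n))" using mult_left_mono[OF R[of n] norm_ge_zero[of "A (y n)"]] by (simp add: mult.commute)
    finally show ?thesis .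
  qed
  \<comment> \<open>The squared gap is at most a constant times the squared gradient at \<open>y n\<close>, whose sum weighted by \<open>\<gamma> n\<close> is finite.\<close>
  have "l\<^sup>2 = 0"
  proof (rule limit_zero_if_weighted_summable[OF \<gamma>(3,1)])
    show "(\<lambda>n. (f (y n) - f z)\<^sup>2) \<longlonglongrightarrow> l\<^sup>2" by (intro tendsto_power l)
    have "summable (\<lambda>n. R\<^sup>2 * (2 * (\<gamma> n * (a n)\<^sup>2) + 2 / \<beta>\<^sup>2 * (\<gamma> n * (norm (e n))\<^sup>2)))"
      by (intro summable_mult summable_add sum_a error)
    then show "summable (\<lambda>n. \<gamma> n * (f (y n) - f z)\<^sup>2)"
    proof (rule summable_comparison_test'[where N = 0])
      fix n
      have "norm (A (y n)) \<le> a n + norm (e n) / \<beta>"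
        using Ay[of n] norm_triangle_sub[of "A (y n)" "A (u n)"] unfolding a_def by linarith
      then have "(norm (A (y n)))\<^sup>2 \<le> (a n + norm (e n) / \<beta>)\<^sup>2" by (intro power_mono) auto
      also have "\<dots> \<le> 2 * (a n)\<^sup>2 + 2 * (norm (e n) / \<beta>)\<^sup>2"
        using sum_squares_bound[of "a n" "norm (e n) / \<beta>"] by (simp add: power2_sum)
      finally have Ay2: "(norm (A (y n)))\<^sup>2 \<le> 2 * (a n)\<^sup>2 + 2 * (norm (e n) / \<beta>)\<^sup>2" .
      have "(f (y n) - f z)\<^sup>2 \<le> (R * norm (A (y n)))\<^sup>2"
        using gap[of n] min[of "y n"] by (intro power_mono) auto
      also have "\<dots> \<le> R\<^sup>2 * (2 * (a n)\<^sup>2 + 2 * (norm (e n) / \<beta>)\<^sup>2)"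
        unfolding power_mult_distrib by (intro mult_left_mono Ay2) simp
      finally have "\<gamma> n * (f (y n) - f z)\<^sup>2 \<le> \<gamma> n * (R\<^sup>2 * (2 * (a n)\<^sup>2 + 2 * (norm (e n) / \<beta>)\<^sup>2))"
        using \<gamma>(1) by (rule mult_left_mono)
      then show "norm (\<gamma> n * (f (y n) - f z)\<^sup>2) \<le>
          R\<^sup>2 * (2 * (\<gamma> n * (a n)\<^sup>2) + 2 / \<beta>\<^sup>2 * (\<gamma> n * (norm (e n))\<^sup>2))"
        using \<gamma>(1)[of n] by (simp add: algebra_simps power_divide)
    qed
  qed auto
  then have f_lim: "(\<lambda>n. f (y n) - f z) \<longlonglongrightarrow> 0" using l by simp
  have "(\<lambda>n. (norm (A (y n)))\<^sup>2) \<longlonglongrightarrow> 0"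
  proof (rule tendsto_sandwich[OF _ _ tendsto_const])
    show "(\<lambda>n. 2 / \<beta> * (f (y n) - f z)) \<longlonglongrightarrow> 0" using tendsto_mult_right_zero[OF f_lim] .
    show "\<forall>\<^sub>F n in sequentially. (norm (A (y n)))\<^sup>2 \<le> 2 / \<beta> * (f (y n) - f z)"
    proof (rule always_eventually, rule allI)
      fix n
      show "(norm (A (y n)))\<^sup>2 \<le> 2 / \<beta> * (f (y n) - f z)"
        using tangent_below_strong[of z "y n"] z beta unfolding Argmin_iff by (simp add: field_simps)
    qed
  qed simp
  then have "(\<lambda>n. norm (A (y n))) \<longlonglongrightarrow> 0" using tendsto_real_sqrt by fastforce
  then have Ay_lim: "(\<lambda>n. A (y n)) \<longlonglongrightarrow> 0" by (rule tendsto_norm_zero_cancel)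
  have "(\<lambda>n. A (y n) - A (u n)) \<longlonglongrightarrow> 0"
  proof (rule Lim_null_comparison[OF always_eventually[OF allI[OF Ay]]])
    show "(\<lambda>n. norm (e n) / \<beta>) \<longlonglongrightarrow> 0"
      using tendsto_divide[OF tendsto_norm[OF e_lim] tendsto_const[of \<beta>]] beta by simp
  qed
  from tendsto_diff[OF Ay_lim this] show "(\<lambda>n. A (u n)) \<longlonglongrightarrow> 0" by simp
  have "\<exists>p\<in>Argmin f. weakly_converges y p"
  proof (rule opial[OF ne dist_conv])
    fix r p assume r: "strict_mono (r :: nat \<Rightarrow> nat)" and p: "weakly_converges (y \<circ> r) p"
    have "(\<lambda>n. inner (y (r n)) (A p)) \<longlonglongrightarrow> inner p (A p)"
      using p unfolding weakly_converges_def by (simp add: o_def)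
    then have "(\<lambda>n. f p + (inner (y (r n)) (A p) - inner p (A p))) \<longlonglongrightarrow> f p + (inner p (A p) - inner p (A p))"
      by (intro tendsto_add tendsto_diff tendsto_const)
    moreover have "(\<lambda>n. f (y (r n)) - f z + f z) \<longlonglongrightarrow> 0 + f z"
      using LIMSEQ_subseq_LIMSEQ[OF f_lim r] by (intro tendsto_intros) (simp add: o_def)
    moreover have "f p + (inner (y (r n)) (A p) - inner p (A p)) \<le> f (y (r n)) - f z + f z" for n
      using tangent_below[of p "y (r n)"] by (simp add: inner_diff_right inner_commute)
    ultimately have "f p + (inner p (A p) - inner p (A p)) \<le> 0 + f z"
      by (meson LIMSEQ_le)
    then show "p \<in> Argmin f"
      using min unfolding Argmin_def is_arg_min_linorder by (auto intro: order_trans)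
  qed
  then obtain p where p: "p \<in> Argmin f" "weakly_converges y p" by blast
  have "weakly_converges u p"
    unfolding weakly_converges_def
  proof
    fix h
    have "(\<lambda>n. inner (y n) h + inner (e n) h) \<longlonglongrightarrow> inner p h + inner 0 h"
      using p(2) unfolding weakly_converges_def
      by (intro tendsto_add tendsto_inner[OF e_lim tendsto_const]) blast
    then show "(\<lambda>n. inner (u n) h) \<longlonglongrightarrow> inner p h"
      unfolding y_def by (simp add: inner_diff_left)
  qed
  then show "\<exists>p\<in>Argmin f. weakly_converges u p" using p(1) by blast
qed

section \<open>Square integrable random variables\<close>

lemma in_Lp_2_iff:
  "in_Lp 2 M x \<longleftrightarrow> x \<in> borel_measurable M \<and> integrable M (\<lambda>\<omega>. (norm (x \<omega>))\<^sup>2)"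
  unfolding in_Lp_def by simp

lemma in_Lp_2_measurable: "in_Lp 2 M x \<Longrightarrow> x \<in> borel_measurable M"
  and in_Lp_2_integrable: "in_Lp 2 M x \<Longrightarrow> integrable M (\<lambda>\<omega>. (norm (x \<omega>))\<^sup>2)"
  unfolding in_Lp_2_iff by auto

lemma in_Lp_2_bound:
  fixes x :: "'w \<Rightarrow> 'a::{real_normed_vector, second_countable_topology}"
  assumes y: "integrable M y" and x: "x \<in> borel_measurable M"
    and le: "AE \<omega> in M. (norm (x \<omega>))\<^sup>2 \<le> y \<omega>"
  shows "in_Lp 2 M x"
  unfolding in_Lp_2_iff
proof
  have [measurable]: "x \<in> borel_measurable M" by fact
  show "integrable M (\<lambda>\<omega>. (norm (x \<omega>))\<^sup>2)"
    by (rule Bochner_Integration.integrable_bound[OF y]) (use le in auto)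
qed fact

lemma in_Lp_2_nn_integral:
  fixes x :: "'w \<Rightarrow> 'a::{real_normed_vector, second_countable_topology}"
  assumes [measurable]: "x \<in> borel_measurable M"
    and le: "(\<integral>\<^sup>+\<omega>. ennreal ((norm (x \<omega>))\<^sup>2) \<partial>M) \<le> ennreal c"  and c: "c \<ge> 0"
  shows "in_Lp 2 M x" and "(\<integral>\<omega>. (norm (x \<omega>))\<^sup>2 \<partial>M) \<le> c"
proof -
  have int: "integrable M (\<lambda>\<omega>. (norm (x \<omega>))\<^sup>2)"
    using le by (intro integrableI_bounded) (auto intro: le_less_trans[OF _ ennreal_less_top])
  then show "in_Lp 2 M x" unfolding in_Lp_2_iff by simp
  have "ennreal (\<integral>\<omega>. (norm (x \<omega>))\<^sup>2 \<partial>M) = (\<integral>\<^sup>+\<omega>. ennreal ((norm (x \<omega>))\<^sup>2) \<partial>M)"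
    by (rule nn_integral_eq_integral[symmetric, OF int]) simp
  then show "(\<integral>\<omega>. (norm (x \<omega>))\<^sup>2 \<partial>M) \<le> c" using le ennreal_le_iff[OF c] by metis
qed

lemma in_Lp_2_add:
  fixes x :: "'w \<Rightarrow> 'a::{real_normed_vector, second_countable_topology}"
  assumes x: "in_Lp 2 M x" and y: "in_Lp 2 M y"
  shows "in_Lp 2 M (\<lambda>\<omega>. x \<omega> + y \<omega>)"
proof (rule in_Lp_2_bound)
  show "integrable M (\<lambda>\<omega>. 2 * (norm (x \<omega>))\<^sup>2 + 2 * (norm (y \<omega>))\<^sup>2)"
    using in_Lp_2_integrable[OF x] in_Lp_2_integrable[OF y] by simp
  show "(\<lambda>\<omega>. x \<omega> + y \<omega>) \<in> borel_measurable M"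
    using in_Lp_2_measurable[OF x] in_Lp_2_measurable[OF y] by (rule borel_measurable_add)
  have "(norm (x \<omega> + y \<omega>))\<^sup>2 \<le> 2 * (norm (x \<omega>))\<^sup>2 + 2 * (norm (y \<omega>))\<^sup>2" for \<omega>
  proof -
    have "(norm (x \<omega> + y \<omega>))\<^sup>2 \<le> (norm (x \<omega>) + norm (y \<omega>))\<^sup>2"
      by (intro power_mono norm_triangle_ineq) simp
    then show ?thesis using sum_squares_bound[of "norm (x \<omega>)" "norm (y \<omega>)"]
      by (simp add: power2_sum)
  qed
  then show "AE \<omega> in M. (norm (x \<omega> + y \<omega>))\<^sup>2 \<le> 2 * (norm (x \<omega>))\<^sup>2 + 2 * (norm (y \<omega>))\<^sup>2" by simp
qed

lemma in_Lp_2_scaleR: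
  fixes x :: "'w \<Rightarrow> 'a::{real_normed_vector, second_countable_topology}"
  assumes "in_Lp 2 M x"
  shows "in_Lp 2 M (\<lambda>\<omega>. c *\<^sub>R x \<omega>)"
  using assms unfolding in_Lp_2_iff
  by (auto simp: power_mult_distrib intro!: borel_measurable_scaleR)

lemma in_Lp_2_diff:
  fixes x :: "'w \<Rightarrow> 'a::{real_normed_vector, second_countable_topology}"
  assumes "in_Lp 2 M x" "in_Lp 2 M y"
  shows "in_Lp 2 M (\<lambda>\<omega>. x \<omega> - y \<omega>)"
  using in_Lp_2_add[OF assms(1) in_Lp_2_scaleR[OF assms(2), of "-1"]] by simp

lemma (in finite_measure) in_Lp_2_const: "in_Lp 2 M (\<lambda>_. c)"
  unfolding in_Lp_2_iff by simp

lemma integrable_norm_mult: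
  fixes x :: "'w \<Rightarrow> 'a::{real_normed_vector, second_countable_topology}"
    and y :: "'w \<Rightarrow> 'b::{real_normed_vector, second_countable_topology}"
  assumes x: "in_Lp 2 M x" and y: "in_Lp 2 M y"
  shows "integrable M (\<lambda>\<omega>. norm (x \<omega>) * norm (y \<omega>))"
proof (rule Bochner_Integration.integrable_bound)
  show "integrable M (\<lambda>\<omega>. (norm (x \<omega>))\<^sup>2 + (norm (y \<omega>))\<^sup>2)"
    using in_Lp_2_integrable[OF x] in_Lp_2_integrable[OF y] by simp
  have [measurable]: "x \<in> borel_measurable M" "y \<in> borel_measurable M"
    using x y by (auto intro: in_Lp_2_measurable)
  show "(\<lambda>\<omega>. norm (x \<omega>) * norm (y \<omega>)) \<in> borel_measurable M" by measurable
  have "norm (x \<omega>) * norm (y \<omega>) \<le> (norm (x \<omega>))\<^sup>2 + (norm (y \<omega>))\<^sup>2" for \<omega>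
  proof -
    have "0 \<le> norm (x \<omega>) * norm (y \<omega>)" by simp
    then show ?thesis using sum_squares_bound[of "norm (x \<omega>)" "norm (y \<omega>)"] by linarith
  qed
  then show "AE \<omega> in M. norm (norm (x \<omega>) * norm (y \<omega>)) \<le> norm ((norm (x \<omega>))\<^sup>2 + (norm (y \<omega>))\<^sup>2)"
    by (auto simp: abs_of_nonneg)
qed

lemma integrable_inner_L2:
  fixes x y :: "'w \<Rightarrow> 'a::{real_inner, second_countable_topology}"
  assumes x: "in_Lp 2 M x" and y: "in_Lp 2 M y"
  shows "integrable M (\<lambda>\<omega>. inner (x \<omega>) (y \<omega>))"
proof (rule Bochner_Integration.integrable_bound[OF integrable_norm_mult[OF x y]])
  have [measurable]: "x \<in> borel_measurable M" "y \<in> borel_measurable M"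
    using x y by (auto intro: in_Lp_2_measurable)
  show "(\<lambda>\<omega>. inner (x \<omega>) (y \<omega>)) \<in> borel_measurable M" by measurable
  show "AE \<omega> in M. norm (inner (x \<omega>) (y \<omega>)) \<le> norm (norm (x \<omega>) * norm (y \<omega>))"
    by (simp add: Cauchy_Schwarz_ineq2)
qed

text \<open>The bounds \<open>Z n\<close> are bounded in \<open>L\<^sup>2\<close> but need not be dominated by one function. Still, by
  Young's inequality, the part of \<open>h n\<close> above \<open>\<delta> (Z n)\<^sup>2\<close> is dominated by \<open>V\<^sup>2 / (4 \<delta>)\<close> and so
  tends to \<open>0\<close> in the mean, and what remains has mean at most \<open>\<delta> C\<close>.\<close>

lemma integral_norm_tendsto_0:
  fixes h :: "nat \<Rightarrow> 'w \<Rightarrow> 'a::{banach, second_countable_topology}"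
    and V :: "'w \<Rightarrow> real" and Z :: "nat \<Rightarrow> 'w \<Rightarrow> real"
  assumes [measurable]: "\<And>n. h n \<in> borel_measurable M"
    and lim: "AE \<omega> in M. (\<lambda>n. h n \<omega>) \<longlonglongrightarrow> 0"
    and le: "\<And>n. AE \<omega> in M. norm (h n \<omega>) \<le> Z n \<omega> * V \<omega>"
    and Z: "\<And>n. in_Lp 2 M (Z n)" and Z_le: "\<And>n. (\<integral>\<omega>. (Z n \<omega>)\<^sup>2 \<partial>M) \<le> C"
    and V: "in_Lp 2 M V"
  shows "integrable M (h n)" and "(\<lambda>n. \<integral>\<omega>. norm (h n \<omega>) \<partial>M) \<longlonglongrightarrow> 0"
proof -
  have [measurable]: "V \<in> borel_measurable M" "\<And>n. Z n \<in> borel_measurable M"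
    using V Z by (auto intro: in_Lp_2_measurable)
  have Z2: "integrable M (\<lambda>\<omega>. (Z n \<omega>)\<^sup>2)" and V2: "integrable M (\<lambda>\<omega>. (V \<omega>)\<^sup>2)" for n
    using in_Lp_2_integrable[OF Z[of n]] in_Lp_2_integrable[OF V] by simp_all
  show int: "integrable M (h n)" for n
  proof (rule Bochner_Integration.integrable_bound[OF integrable_norm_mult[OF Z[of n] V]])
    show "AE \<omega> in M. norm (h n \<omega>) \<le> norm (norm (Z n \<omega>) * norm (V \<omega>))"
      using le[of n] by eventually_elim (simp add: abs_mult[symmetric])
  qed measurable
  have "0 \<le> (\<integral>\<omega>. (Z 0 \<omega>)\<^sup>2 \<partial>M)" by simp
  with Z_le[of 0] have C: "C \<ge> 0" by linarith
  show "(\<lambda>n. \<integral>\<omega>. norm (h n \<omega>) \<partial>M) \<longlonglongrightarrow> 0"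
  proof (rule LIMSEQ_I)
    fix \<epsilon> :: real assume \<epsilon>: "\<epsilon> > 0"
    define \<delta> where "\<delta> = \<epsilon> / (2 * (C + 1))"
    have \<delta>: "\<delta> > 0" using \<epsilon> C unfolding \<delta>_def by simp
    have \<delta>C: "\<delta> * C \<le> \<epsilon> / 2"
    proof -
      have "\<delta> * C \<le> \<delta> * (C + 1)" using \<delta> by simp
      also have "\<dots> = \<epsilon> / 2" using C unfolding \<delta>_def by (simp add: field_simps)
      finally show ?thesis .
    qed
    define k where "k n \<omega> = max 0 (norm (h n \<omega>) - \<delta> * (Z n \<omega>)\<^sup>2)" for n \<omega>
    have [measurable]: "k n \<in> borel_measurable M" for n unfolding k_def by measurable
    have k_le: "AE \<omega> in M. norm (k n \<omega>) \<le> (V \<omega>)\<^sup>2 / (4 * \<delta>)" for n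
      using le[of n]
    proof eventually_elim
      case (elim \<omega>)
      have "0 \<le> (2 * \<delta> * Z n \<omega> - V \<omega>)\<^sup>2 / (4 * \<delta>)" using \<delta> by simp
      also have "\<dots> = \<delta> * (Z n \<omega>)\<^sup>2 - Z n \<omega> * V \<omega> + (V \<omega>)\<^sup>2 / (4 * \<delta>)"
        using \<delta> by (simp add: power2_diff power_mult_distrib power2_eq_square[of \<delta>] diff_divide_distrib add_divide_distrib)
      finally have "Z n \<omega> * V \<omega> - \<delta> * (Z n \<omega>)\<^sup>2 \<le> (V \<omega>)\<^sup>2 / (4 * \<delta>)" by linarith
      moreover have "0 \<le> (V \<omega>)\<^sup>2 / (4 * \<delta>)" using \<delta> by simp
      ultimately show ?case using elim unfolding k_def by simp
    qed
    have k_lim: "AE \<omega> in M. (\<lambda>n. k n \<omega>) \<longlonglongrightarrow> 0"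
      using lim
    proof eventually_elim
      case (elim \<omega>)
      show ?case
      proof (rule tendsto_sandwich[OF _ _ tendsto_const])
        show "(\<lambda>n. norm (h n \<omega>)) \<longlonglongrightarrow> 0" using tendsto_norm[OF elim] by simp
        show "\<forall>\<^sub>F n in sequentially. k n \<omega> \<le> norm (h n \<omega>)" using \<delta> unfolding k_def by simp
      qed (simp add: k_def)
    qed
    have k_int: "integrable M (k n)" for n
      by (rule Bochner_Integration.integrable_bound[OF integrable_divide[OF V2, of "4 * \<delta>"]])
        (use k_le[of n] \<delta> in \<open>auto elim!: eventually_mono\<close>)
    have "(\<lambda>n. \<integral>\<omega>. k n \<omega> \<partial>M) \<longlonglongrightarrow> (\<integral>\<omega>. 0 \<partial>M)"
      by (rule integral_dominated_convergence[OF _ _ integrable_divide[OF V2, of "4 * \<delta>"] k_lim k_le]) measurable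
    then obtain N where N: "\<And>n. n \<ge> N \<Longrightarrow> (\<integral>\<omega>. k n \<omega> \<partial>M) < \<epsilon> / 2"
      using order_tendstoD(2)[of _ "0::real" sequentially "\<epsilon> / 2"] \<epsilon>
      unfolding eventually_sequentially by auto
    have "norm ((\<integral>\<omega>. norm (h n \<omega>) \<partial>M) - 0) < \<epsilon>" if "n \<ge> N" for n
    proof -
      have "(\<integral>\<omega>. norm (h n \<omega>) \<partial>M) \<le> (\<integral>\<omega>. k n \<omega> + \<delta> * (Z n \<omega>)\<^sup>2 \<partial>M)"
        by (intro integral_mono Bochner_Integration.integrable_add k_int integrable_norm int
            integrable_mult_right Z2) (simp add: k_def)
      also have "\<dots> = (\<integral>\<omega>. k n \<omega> \<partial>M) + \<delta> * (\<integral>\<omega>. (Z n \<omega>)\<^sup>2 \<partial>M)"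
        using k_int Z2 by simp
      also have "\<dots> < \<epsilon> / 2 + \<epsilon> / 2"
      proof (rule add_less_le_mono[OF N[OF that]])
        have "\<delta> * (\<integral>\<omega>. (Z n \<omega>)\<^sup>2 \<partial>M) \<le> \<delta> * C" using Z_le \<delta> by simp
        then show "\<delta> * (\<integral>\<omega>. (Z n \<omega>)\<^sup>2 \<partial>M) \<le> \<epsilon> / 2" using \<delta>C by linarith
      qed
      finally show ?thesis by simp
    qed
    then show "\<exists>N. \<forall>n\<ge>N. norm ((\<integral>\<omega>. norm (h n \<omega>) \<partial>M) - 0) < \<epsilon>" by blast
  qed
qed

text \<open>Pettis' theorem. A countable dense set \<open>D\<close> detects norms through inner products,
  \<open>c < norm v\<close> iff \<open>c * norm d < inner v d\<close> for some \<open>d\<close> in \<open>D\<close>, so preimages of balls are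
  measurable; every open set is a countable union of balls.\<close>

lemma borel_measurable_weakly:
  fixes x :: "'w \<Rightarrow> 'a::{real_inner, second_countable_topology}"
  assumes meas [measurable]: "\<And>y. (\<lambda>\<omega>. inner (x \<omega>) y) \<in> borel_measurable M"
  shows "x \<in> borel_measurable M"
proof -
  obtain D :: "'a set" where D: "countable D" "\<And>U. open U \<Longrightarrow> U \<noteq> {} \<Longrightarrow> \<exists>d\<in>D. d \<in> U"
    by (rule countable_dense_setE) blast
  have norm_gt: "c < norm v \<longleftrightarrow> (\<exists>d\<in>D. c * norm d < inner v d)" if c: "c \<ge> 0" for c and v :: 'a
  proof
    assume "c < norm v"
    then have "0 < norm v" using c by linarith
    with \<open>c < norm v\<close> have "c * norm v < norm v * norm v" by (rule mult_strict_right_mono)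
    then have "v \<in> {d. c * norm d < inner v d}"
      by (simp add: power2_norm_eq_inner[symmetric] power2_eq_square[symmetric])
    moreover have "open {d. c * norm d < inner v d}" by (intro open_Collect_less continuous_intros)
    ultimately show "\<exists>d\<in>D. c * norm d < inner v d"
      using D(2)[of "{d. c * norm d < inner v d}"] by blast
  next
    assume "\<exists>d\<in>D. c * norm d < inner v d"
    then obtain d where "c * norm d < inner v d" by blast
    also have "\<dots> \<le> norm v * norm d" by (rule norm_cauchy_schwarz)
    finally show "c < norm v" by (rule mult_right_less_imp_less) simp
  qed
  have dist_meas [measurable]: "(\<lambda>\<omega>. norm (x \<omega> - a)) \<in> borel_measurable M" for a
  proof (rule borel_measurableI_greater)
    fix c :: real
    show "{\<omega> \<in> space M. c < norm (x \<omega> - a)} \<in> sets M"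
    proof (cases "c \<ge> 0")
      case True
      then have "{\<omega> \<in> space M. c < norm (x \<omega> - a)} =
          (\<Union>d\<in>D. {\<omega> \<in> space M. c * norm d < inner (x \<omega>) d - inner a d})"
        by (auto simp: norm_gt inner_diff_left)
      also have "\<dots> \<in> sets M" by (intro sets.countable_UN'' D(1)) measurable
      finally show ?thesis .
    next
      case False
      then have "{\<omega> \<in> space M. c < norm (x \<omega> - a)} = space M"
        by (auto intro: less_le_trans[OF _ norm_ge_zero])
      then show ?thesis by simp
    qed
  qed
  show ?thesis
  proof (rule borel_measurableI)
    fix U :: "'a set" assume U: "open U"
    define B where "B = {(d, q). d \<in> D \<and> q \<in> \<rat> \<and> ball d q \<subseteq> U}"
    have "countable B"
      by (rule countable_subset[of _ "D \<times> \<rat>"]) (auto simp: B_def D(1) countable_rat)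
    have "U = (\<Union>b\<in>B. ball (fst b) (snd b))"
    proof (intro equalityI subsetI)
      fix v assume "v \<in> U"
      then obtain e where e: "e > 0" "ball v e \<subseteq> U" using U openE by blast
      obtain q where q: "q \<in> \<rat>" "0 < q" "q < e / 2" using Rats_dense_in_real[of 0 "e / 2"] e by auto
      obtain d where d: "d \<in> D" "dist v d < q"
        using D(2)[of "ball v q"] q by auto
      have "ball d q \<subseteq> ball v e"
      proof
        fix w assume "w \<in> ball d q"
        then show "w \<in> ball v e" using d q dist_triangle[of v w d] by simp
      qed
      then have "(d, q) \<in> B" using d q e unfolding B_def by auto
      then show "v \<in> (\<Union>b\<in>B. ball (fst b) (snd b))"
        using d by (intro UN_I[of "(d, q)"]) (auto simp: dist_commute)
    qed (auto simp: B_def)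
    then have "x -` U \<inter> space M = (\<Union>b\<in>B. {\<omega> \<in> space M. norm (x \<omega> - fst b) < snd b})"
      by (auto simp: dist_norm norm_minus_commute intro!: bexI[rotated])
    also have "\<dots> \<in> sets M"
      using \<open>countable B\<close> by (intro sets.countable_UN'') measurable
    finally show "x -` U \<inter> space M \<in> sets M" .
  qed
qed

lemma (in complete_measure) borel_measurable_AE_eq:
  assumes y: "y \<in> measurable M N" and eq: "AE \<omega> in M. x \<omega> = y \<omega>"
    and x: "\<And>\<omega>. \<omega> \<in> space M \<Longrightarrow> x \<omega> \<in> space N"
  shows "x \<in> measurable M N"
proof (rule measurableI[OF x])
  fix B assume B: "B \<in> sets N"
  show "x -` B \<inter> space M \<in> sets M"
  proof (rule in_sets_AE)
    show "y -` B \<inter> space M \<in> sets M" using y B by (rule measurable_sets)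
    show "AE \<omega> in M. \<omega> \<in> y -` B \<inter> space M \<longleftrightarrow> \<omega> \<in> x -` B \<inter> space M"
      using eq AE_space by eventually_elim auto
  qed simp
qed

section \<open>Independence and square integrable martingales\<close>

lemma (in prob_space) distr_pair_indep:
  assumes k: "k \<in> measurable M K" and W: "W \<in> measurable F N" and sub: "subalgebra M F"
    and indep: "indep_set (sets (vimage_algebra (space M) k K)) (sets F)"
  shows "distr M (K \<Otimes>\<^sub>M N) (\<lambda>\<omega>. (k \<omega>, W \<omega>)) = distr M K k \<Otimes>\<^sub>M distr M N W"
proof -
  have W': "W \<in> measurable M N" using W sub by (rule measurable_from_subalg[rotated])
  have kW: "(\<lambda>\<omega>. (k \<omega>, W \<omega>)) \<in> measurable M (K \<Otimes>\<^sub>M N)" using k W' by (rule measurable_Pair)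
  interpret k: prob_space "distr M K k" by (rule prob_space_distr) fact
  interpret W: prob_space "distr M N W" by (rule prob_space_distr) fact
  have "distr M K k \<Otimes>\<^sub>M distr M N W = distr M (K \<Otimes>\<^sub>M N) (\<lambda>\<omega>. (k \<omega>, W \<omega>))"
  proof (rule pair_measure_eqI)
    fix B C assume "B \<in> sets (distr M K k)" "C \<in> sets (distr M N W)"
    then have B: "B \<in> sets K" and C: "C \<in> sets N" by simp_all
    have "k -` B \<inter> space M \<in> sets (vimage_algebra (space M) k K)"
      using B by (rule in_vimage_algebra)
    moreover have "W -` C \<inter> space M \<in> sets F"
      using measurable_sets[OF W C] sub by (simp add: subalgebra_def)
    ultimately have "prob ((k -` B \<inter> space M) \<inter> (W -` C \<inter> space M)) =
        prob (k -` B \<inter> space M) * prob (W -` C \<inter> space M)"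
      by (rule indep_setD[OF indep])
    moreover have "(\<lambda>\<omega>. (k \<omega>, W \<omega>)) -` (B \<times> C) \<inter> space M =
        (k -` B \<inter> space M) \<inter> (W -` C \<inter> space M)" by auto
    ultimately show "emeasure (distr M K k) B * emeasure (distr M N W) C =
        emeasure (distr M (K \<Otimes>\<^sub>M N) (\<lambda>\<omega>. (k \<omega>, W \<omega>))) (B \<times> C)"
      using B C by (simp add: emeasure_distr k W' kW emeasure_eq_measure ennreal_mult[symmetric])
  qed (simp_all add: k.sigma_finite_measure_axioms W.sigma_finite_measure_axioms)
  then show ?thesis ..
qed

text \<open>Averaging over \<open>k\<close>, which is independent of \<open>F\<close>, may be done with the \<open>F\<close>-measurable
  variable \<open>W\<close> frozen: the joint law is a product and Tonelli's theorem applies.\<close>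

lemma (in prob_space) freezing_nn_integral:
  assumes k: "k \<in> measurable M K" and W: "W \<in> measurable F N" and sub: "subalgebra M F"
    and indep: "indep_set (sets (vimage_algebra (space M) k K)) (sets F)"
    and \<phi>: "\<phi> \<in> borel_measurable (K \<Otimes>\<^sub>M N)"
    and le: "\<And>w. w \<in> space N \<Longrightarrow> (\<integral>\<^sup>+\<kappa>. \<phi> (\<kappa>, w) \<partial>distr M K k) \<le> c"
  shows "(\<integral>\<^sup>+\<omega>. \<phi> (k \<omega>, W \<omega>) \<partial>M) \<le> c"
proof -
  have W': "W \<in> measurable M N" using W sub by (rule measurable_from_subalg[rotated])
  have kW: "(\<lambda>\<omega>. (k \<omega>, W \<omega>)) \<in> measurable M (K \<Otimes>\<^sub>M N)" using k W' by (rule measurable_Pair)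
  interpret k: prob_space "distr M K k" by (rule prob_space_distr) fact
  interpret W: prob_space "distr M N W" by (rule prob_space_distr) fact
  interpret kW: pair_prob_space "distr M K k" "distr M N W" ..
  have "(\<integral>\<^sup>+\<omega>. \<phi> (k \<omega>, W \<omega>) \<partial>M) = (\<integral>\<^sup>+p. \<phi> p \<partial>(distr M K k \<Otimes>\<^sub>M distr M N W))"
    unfolding distr_pair_indep[OF k W sub indep, symmetric] using kW \<phi> by (simp add: nn_integral_distr)
  also have "\<dots> = (\<integral>\<^sup>+w. (\<integral>\<^sup>+\<kappa>. \<phi> (\<kappa>, w) \<partial>distr M K k) \<partial>distr M N W)"
    by (rule kW.nn_integral_snd[symmetric]) (use \<phi> in simp)
  also have "\<dots> \<le> (\<integral>\<^sup>+w. c \<partial>distr M N W)"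
    by (rule nn_integral_mono) (use le in simp)
  finally show ?thesis using W.emeasure_space_1 by simp
qed

lemma (in prob_space) freezing_integral_0:
  fixes \<phi> :: "'k \<times> 'n \<Rightarrow> real"
  assumes k: "k \<in> measurable M K" and W: "W \<in> measurable F N" and sub: "subalgebra M F"
    and indep: "indep_set (sets (vimage_algebra (space M) k K)) (sets F)"
    and \<phi>: "\<phi> \<in> borel_measurable (K \<Otimes>\<^sub>M N)"
    and int: "integrable M (\<lambda>\<omega>. \<phi> (k \<omega>, W \<omega>))"
    and zero: "\<And>w. w \<in> space N \<Longrightarrow> (\<integral>\<kappa>. \<phi> (\<kappa>, w) \<partial>distr M K k) = 0"
  shows "(\<integral>\<omega>. \<phi> (k \<omega>, W \<omega>) \<partial>M) = 0"
proof -
  have W': "W \<in> measurable M N" using W sub by (rule measurable_from_subalg[rotated])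
  have kW: "(\<lambda>\<omega>. (k \<omega>, W \<omega>)) \<in> measurable M (K \<Otimes>\<^sub>M N)" using k W' by (rule measurable_Pair)
  interpret k: prob_space "distr M K k" by (rule prob_space_distr) fact
  interpret W: prob_space "distr M N W" by (rule prob_space_distr) fact
  interpret kW: pair_prob_space "distr M K k" "distr M N W" ..
  have int': "integrable (distr M K k \<Otimes>\<^sub>M distr M N W) \<phi>"
    unfolding distr_pair_indep[OF k W sub indep, symmetric] using kW \<phi> int
    by (simp add: integrable_distr_eq)
  have "(\<integral>\<omega>. \<phi> (k \<omega>, W \<omega>) \<partial>M) = (\<integral>p. \<phi> p \<partial>(distr M K k \<Otimes>\<^sub>M distr M N W))"
    unfolding distr_pair_indep[OF k W sub indep, symmetric] using kW \<phi> by (simp add: integral_distr)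
  also have "\<dots> = (\<integral>w. (\<integral>\<kappa>. \<phi> (\<kappa>, w) \<partial>distr M K k) \<partial>distr M N W)"
    using kW.integral_snd[of "\<lambda>\<kappa> w. \<phi> (\<kappa>, w)"] int' by simp
  also have "\<dots> = (\<integral>w. 0 \<partial>distr M N W)"
    by (rule Bochner_Integration.integral_cong) (use zero in auto)
  finally show ?thesis by simp
qed

text \<open>The partial sums of \<open>V\<close>, stopped once their norm exceeds \<open>\<epsilon>\<close>. Defining the stopped sums
  directly, instead of a stopping time, makes their adaptedness evident by induction.\<close>

primrec stopped_sum :: "real \<Rightarrow> (nat \<Rightarrow> 'w \<Rightarrow> 'a::real_normed_vector) \<Rightarrow> nat \<Rightarrow> 'w \<Rightarrow> 'a" where
  "stopped_sum \<epsilon> V 0 \<omega> = 0"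
| "stopped_sum \<epsilon> V (Suc n) \<omega> =
    stopped_sum \<epsilon> V n \<omega> + indicator {..\<epsilon>} (norm (stopped_sum \<epsilon> V n \<omega>)) *\<^sub>R V n \<omega>"

lemma stopped_sum_exceeds:
  assumes "norm (\<Sum>i<j. V i \<omega>) > \<epsilon>" "j \<le> n"
  shows "norm (stopped_sum \<epsilon> V n \<omega>) > \<epsilon>"
proof -
  \<comment> \<open>The indicator vanishes once the bound is exceeded.\<close>
  have persists: "norm (stopped_sum \<epsilon> V n \<omega>) > \<epsilon> \<Longrightarrow> norm (stopped_sum \<epsilon> V (Suc n) \<omega>) > \<epsilon>" for n
    by simp
  have unstopped: "norm (stopped_sum \<epsilon> V n \<omega>) > \<epsilon> \<or> stopped_sum \<epsilon> V n \<omega> = (\<Sum>i<n. V i \<omega>)" for n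
  proof (induction n)
    case (Suc n)
    then show ?case using persists[of n] by (cases "norm (stopped_sum \<epsilon> V n \<omega>) > \<epsilon>") auto
  qed simp
  from unstopped[of j] assms(1) have "norm (stopped_sum \<epsilon> V j \<omega>) > \<epsilon>" by auto
  with assms(2) show ?thesis
    by (induction n rule: dec_induct) (use persists in auto)
qed

locale martingale_differences = prob_space +
  fixes F :: "nat \<Rightarrow> 'a measure" and V :: "nat \<Rightarrow> 'a \<Rightarrow> 'b::{real_inner, banach, second_countable_topology}"
    and c :: "nat \<Rightarrow> real"
  assumes sub: "\<And>n. subalgebra M (F n)"
    and filtration: "\<And>n. sets (F n) \<subseteq> sets (F (Suc n))"
    and adapted: "\<And>n. V n \<in> borel_measurable (F (Suc n))"
    and V_L2: "\<And>n. in_Lp 2 M (V n)"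
    and orth: "\<And>n Y. Y \<in> borel_measurable (F n) \<Longrightarrow> in_Lp 2 M Y \<Longrightarrow>
      (\<integral>\<omega>. inner (V n \<omega>) (Y \<omega>) \<partial>M) = 0"
    and var: "\<And>n. (\<integral>\<omega>. (norm (V n \<omega>))\<^sup>2 \<partial>M) \<le> c n"
begin

lemma shifted: "martingale_differences M (\<lambda>n. F (m + n)) (\<lambda>n. V (m + n)) (\<lambda>n. c (m + n))"
  by unfold_locales (use sub filtration adapted V_L2 orth var in auto)

lemma measurable_step: "y \<in> measurable (F n) N \<Longrightarrow> y \<in> measurable (F (Suc n)) N"
  using sub[of n] sub[of "Suc n"] filtration[of n]
  by (intro measurable_from_subalg[of "F (Suc n)" "F n"]) (auto simp: subalgebra_def)

lemma c_nonneg: "c n \<ge> 0"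
proof -
  have "0 \<le> (\<integral>\<omega>. (norm (V n \<omega>))\<^sup>2 \<partial>M)" by simp
  with var[of n] show ?thesis by linarith
qed

text \<open>Pythagoras; the factor \<open>p\<close> covers both the plain partial sums (\<open>p = 1\<close>) and the stopped
  ones (\<open>p\<close> the indicator that the sum still runs).\<close>

lemma second_moment_step:
  assumes R: "R \<in> borel_measurable (F n)" "in_Lp 2 M R"
    and p: "p \<in> borel_measurable (F n)" "\<And>\<omega>. p \<omega> = 0 \<or> p \<omega> = (1::real)"
  shows "in_Lp 2 M (\<lambda>\<omega>. R \<omega> + p \<omega> *\<^sub>R V n \<omega>)"
    and "(\<integral>\<omega>. (norm (R \<omega> + p \<omega> *\<^sub>R V n \<omega>))\<^sup>2 \<partial>M) \<le> (\<integral>\<omega>. (norm (R \<omega>))\<^sup>2 \<partial>M) + c n"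
proof -
  have [measurable]: "R \<in> borel_measurable M" "p \<in> borel_measurable M" "V n \<in> borel_measurable M"
    using R(1) p(1) sub measurable_from_subalg in_Lp_2_measurable[OF V_L2] by blast+
  have p_bd: "p \<omega> * p \<omega> \<le> 1" for \<omega> using p(2)[of \<omega>] by auto
  have pV: "in_Lp 2 M (\<lambda>\<omega>. p \<omega> *\<^sub>R V n \<omega>)"
    by (rule in_Lp_2_bound[OF in_Lp_2_integrable[OF V_L2[of n]]])
      (auto simp: power_mult_distrib power2_eq_square[of "p _"] intro!: AE_I2 mult_left_le_one_le p_bd)
  have pR: "in_Lp 2 M (\<lambda>\<omega>. p \<omega> *\<^sub>R R \<omega>)"
    by (rule in_Lp_2_bound[OF in_Lp_2_integrable[OF R(2)]])
      (auto simp: power_mult_distrib power2_eq_square[of "p _"] intro!: AE_I2 mult_left_le_one_le p_bd)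
  show "in_Lp 2 M (\<lambda>\<omega>. R \<omega> + p \<omega> *\<^sub>R V n \<omega>)" using R(2) pV by (rule in_Lp_2_add)
  have "(\<lambda>\<omega>. p \<omega> *\<^sub>R R \<omega>) \<in> borel_measurable (F n)" using p(1) R(1) by (rule borel_measurable_scaleR)
  then have cross: "(\<integral>\<omega>. inner (V n \<omega>) (p \<omega> *\<^sub>R R \<omega>) \<partial>M) = 0" using pR by (rule orth)
  have "(\<integral>\<omega>. (norm (R \<omega> + p \<omega> *\<^sub>R V n \<omega>))\<^sup>2 \<partial>M) =
      (\<integral>\<omega>. (norm (R \<omega>))\<^sup>2 + 2 * inner (V n \<omega>) (p \<omega> *\<^sub>R R \<omega>) + (norm (p \<omega> *\<^sub>R V n \<omega>))\<^sup>2 \<partial>M)"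
    by (rule Bochner_Integration.integral_cong[OF refl], simp only: power2_norm_eq_inner)
      (simp add: inner_add_left inner_add_right inner_commute)
  also have "\<dots> = (\<integral>\<omega>. (norm (R \<omega>))\<^sup>2 \<partial>M) + 2 * (\<integral>\<omega>. inner (V n \<omega>) (p \<omega> *\<^sub>R R \<omega>) \<partial>M)
      + (\<integral>\<omega>. (norm (p \<omega> *\<^sub>R V n \<omega>))\<^sup>2 \<partial>M)"
    using in_Lp_2_integrable[OF R(2)] in_Lp_2_integrable[OF pV] integrable_inner_L2[OF V_L2 pR, of n]
    by (simp del: norm_scaleR inner_scaleR_right)
  also have "(\<integral>\<omega>. (norm (p \<omega> *\<^sub>R V n \<omega>))\<^sup>2 \<partial>M) \<le> (\<integral>\<omega>. (norm (V n \<omega>))\<^sup>2 \<partial>M)"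
    by (rule integral_mono[OF in_Lp_2_integrable[OF pV] in_Lp_2_integrable[OF V_L2]])
      (auto simp: power_mult_distrib power2_eq_square[of "p _"] intro!: mult_left_le_one_le p_bd)
  also have "\<dots> \<le> c n" by (rule var)
  finally show "(\<integral>\<omega>. (norm (R \<omega> + p \<omega> *\<^sub>R V n \<omega>))\<^sup>2 \<partial>M) \<le> (\<integral>\<omega>. (norm (R \<omega>))\<^sup>2 \<partial>M) + c n"
    unfolding cross by simp
qed

lemma second_moment_partial_sum:
  "(\<lambda>\<omega>. \<Sum>i<n. V i \<omega>) \<in> borel_measurable (F n)"
  "in_Lp 2 M (\<lambda>\<omega>. \<Sum>i<n. V i \<omega>)"
  "(\<integral>\<omega>. (norm (\<Sum>i<n. V i \<omega>))\<^sup>2 \<partial>M) \<le> (\<Sum>i<n. c i)"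
proof (induction n)
  case 0
  { case 1 show ?case by simp }
  { case 2 show ?case using in_Lp_2_const[of 0] by simp }
  { case 3 show ?case by simp }
next
  case (Suc n)
  { case 1 show ?case
      using borel_measurable_add[OF measurable_step[OF Suc(1)] adapted[of n]] by simp }
  note step = second_moment_step[OF Suc(1,2), of "\<lambda>_. 1"]
  { case 2 show ?case using step(1) by simp }
  { case 3 show ?case using step(2) Suc(3) by simp }
qed

lemma second_moment_stopped_sum:
  "stopped_sum \<epsilon> V n \<in> borel_measurable (F n)"
  "in_Lp 2 M (stopped_sum \<epsilon> V n)"
  "(\<integral>\<omega>. (norm (stopped_sum \<epsilon> V n \<omega>))\<^sup>2 \<partial>M) \<le> (\<Sum>i<n. c i)"
proof (induction n)
  case 0
  have eq: "stopped_sum \<epsilon> V 0 = (\<lambda>_. 0)" by auto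
  { case 1 show ?case unfolding eq by simp }
  { case 2 show ?case unfolding eq by (rule in_Lp_2_const) }
  { case 3 show ?case by simp }
next
  case (Suc n)
  define p where "p \<omega> = (indicator {..\<epsilon>} (norm (stopped_sum \<epsilon> V n \<omega>)) :: real)" for \<omega>
  have eq: "stopped_sum \<epsilon> V (Suc n) = (\<lambda>\<omega>. stopped_sum \<epsilon> V n \<omega> + p \<omega> *\<^sub>R V n \<omega>)"
    unfolding p_def by auto
  have p: "p \<in> borel_measurable (F n)" unfolding p_def using Suc(1) by measurable
  have p01: "p \<omega> = 0 \<or> p \<omega> = 1" for \<omega> unfolding p_def by (simp add: indicator_def)
  note step = second_moment_step[OF Suc(1,2) p p01]
  { case 1 show ?case
      unfolding eq using borel_measurable_add[OF measurable_step[OF Suc(1)]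
          borel_measurable_scaleR[OF measurable_step[OF p] adapted[of n]]] . }
  { case 2 show ?case unfolding eq by (rule step(1)) }
  { case 3 show ?case unfolding eq using step(2) Suc(3) by simp }
qed

text \<open>Kolmogorov's inequality. If some partial sum up to \<open>n\<close> exceeds \<open>\<epsilon>\<close>, then the stopped sum does
  so at time \<open>n\<close>, hence Chebyshev's inequality for the stopped sum controls all of them at once.\<close>

lemma maximal_inequality:
  assumes \<epsilon>: "\<epsilon> > 0" and c: "summable c"
  shows "prob {\<omega> \<in> space M. \<exists>j. norm (\<Sum>i<j. V i \<omega>) > \<epsilon>} \<le> suminf c / \<epsilon>\<^sup>2"
proof -
  have [measurable]: "stopped_sum \<epsilon> V n \<in> borel_measurable M" for n
    using second_moment_stopped_sum(2) by (rule in_Lp_2_measurable)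
  have [measurable]: "(\<lambda>\<omega>. \<Sum>i<n. V i \<omega>) \<in> borel_measurable M" for n
    using second_moment_partial_sum(2) by (rule in_Lp_2_measurable)
  define E where "E n = {\<omega> \<in> space M. \<exists>j\<le>n. norm (\<Sum>i<j. V i \<omega>) > \<epsilon>}" for n
  have [measurable]: "E n \<in> sets M" for n unfolding E_def by measurable
  have E_le: "prob (E n) \<le> suminf c / \<epsilon>\<^sup>2" for n
  proof -
    have "prob (E n) = (\<integral>\<omega>. indicator (E n) \<omega> \<partial>M)" by simp
    also have "\<dots> \<le> (\<integral>\<omega>. (norm (stopped_sum \<epsilon> V n \<omega>))\<^sup>2 / \<epsilon>\<^sup>2 \<partial>M)"
    proof (rule integral_mono)
      show "integrable M (\<lambda>\<omega>. (norm (stopped_sum \<epsilon> V n \<omega>))\<^sup>2 / \<epsilon>\<^sup>2)"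
        using in_Lp_2_integrable[OF second_moment_stopped_sum(2)[of \<epsilon> n]] by simp
      show "indicator (E n) \<omega> \<le> (norm (stopped_sum \<epsilon> V n \<omega>))\<^sup>2 / \<epsilon>\<^sup>2" for \<omega>
      proof (cases "\<omega> \<in> E n")
        case True
        then obtain j where "\<epsilon> < norm (\<Sum>i<j. V i \<omega>)" "j \<le> n" unfolding E_def by auto
        then have "\<epsilon> < norm (stopped_sum \<epsilon> V n \<omega>)" by (rule stopped_sum_exceeds)
        then have "\<epsilon>\<^sup>2 \<le> (norm (stopped_sum \<epsilon> V n \<omega>))\<^sup>2" using \<epsilon> by (intro power_mono) auto
        then show ?thesis using True \<epsilon> by simp
      qed simp
    qed (simp add: emeasure_eq_measure)
    also have "\<dots> = (\<integral>\<omega>. (norm (stopped_sum \<epsilon> V n \<omega>))\<^sup>2 \<partial>M) / \<epsilon>\<^sup>2" by simp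
    also have "\<dots> \<le> (\<Sum>i<n. c i) / \<epsilon>\<^sup>2"
      by (intro divide_right_mono second_moment_stopped_sum(3)) simp
    also have "\<dots> \<le> suminf c / \<epsilon>\<^sup>2"
      using c c_nonneg by (intro divide_right_mono sum_le_suminf) auto
    finally show ?thesis .
  qed
  have "(\<lambda>n. prob (E n)) \<longlonglongrightarrow> prob (\<Union>n. E n)"
    by (rule finite_Lim_measure_incseq) (auto simp: incseq_def E_def intro: order_trans)
  then have "prob (\<Union>n. E n) \<le> suminf c / \<epsilon>\<^sup>2" by (rule LIMSEQ_le_const2) (use E_le in blast)
  also have "(\<Union>n. E n) = {\<omega> \<in> space M. \<exists>j. norm (\<Sum>i<j. V i \<omega>) > \<epsilon>}" unfolding E_def by auto
  finally show ?thesis .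
qed

end

lemma suminf_shift_tendsto_0:
  fixes c :: "nat \<Rightarrow> real"
  assumes "summable c"
  shows "(\<lambda>m. \<Sum>i. c (m + i)) \<longlonglongrightarrow> 0"
proof -
  have "(\<lambda>m. suminf c - (\<Sum>i<m. c i)) \<longlonglongrightarrow> suminf c - suminf c"
    by (intro tendsto_intros summable_LIMSEQ assms)
  moreover have "(\<Sum>i. c (m + i)) = suminf c - (\<Sum>i<m. c i)" for m
    using suminf_split_initial_segment[OF assms, of m] by (simp add: add.commute)
  ultimately show ?thesis by simp
qed

context martingale_differences
begin

text \<open>The maximal inequality, applied to the sequence shifted by \<open>m\<close>, bounds the probability of an
  oscillation above \<open>\<epsilon>\<close> after time \<open>m\<close> by a tail of \<open>\<Sum> c\<close>, so almost every path is Cauchy.\<close>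

lemma AE_convergent_partial_sums:
  assumes c: "summable c"
  shows "AE \<omega> in M. convergent (\<lambda>n. \<Sum>i<n. V i \<omega>)"
proof -
  define S where "S n \<omega> = (\<Sum>i<n. V i \<omega>)" for n \<omega>
  have [measurable]: "S n \<in> borel_measurable M" for n
    unfolding S_def using second_moment_partial_sum(2) by (rule in_Lp_2_measurable)
  have small: "AE \<omega> in M. \<exists>m. \<forall>j. norm (S (m + j) \<omega> - S m \<omega>) \<le> \<epsilon>" if \<epsilon>: "\<epsilon> > 0" for \<epsilon>
  proof -
    define B where "B m = {\<omega> \<in> space M. \<exists>j. norm (S (m + j) \<omega> - S m \<omega>) > \<epsilon>}" for m
    have [measurable]: "B m \<in> sets M" for m unfolding B_def by measurable
    have B_le: "prob (B m) \<le> (\<Sum>i. c (m + i)) / \<epsilon>\<^sup>2" for m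
    proof -
      interpret m: martingale_differences M "\<lambda>n. F (m + n)" "\<lambda>n. V (m + n)" "\<lambda>n. c (m + n)"
        by (rule shifted)
      have "S (m + j) \<omega> - S m \<omega> = (\<Sum>i<j. V (m + i) \<omega>)" for j \<omega>
        unfolding S_def by (induction j) simp_all
      then have "B m = {\<omega> \<in> space M. \<exists>j. norm (\<Sum>i<j. V (m + i) \<omega>) > \<epsilon>}"
        unfolding B_def by simp
      then show ?thesis
        using m.maximal_inequality[OF \<epsilon>] summable_ignore_initial_segment[OF c, of m]
        by (simp add: add.commute)
    qed
    have "prob (\<Inter>m. B m) \<le> 0"
    proof (rule LIMSEQ_le_const)
      show "(\<lambda>m. (\<Sum>i. c (m + i)) / \<epsilon>\<^sup>2) \<longlonglongrightarrow> 0"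
        using tendsto_divide[OF suminf_shift_tendsto_0[OF c] tendsto_const[of "\<epsilon>\<^sup>2"]] \<epsilon> by simp
      have "prob (\<Inter>m. B m) \<le> (\<Sum>i. c (m + i)) / \<epsilon>\<^sup>2" for m
        using finite_measure_mono[of "\<Inter>m. B m" "B m"] B_le[of m] by fastforce
      then show "\<exists>N. \<forall>m\<ge>N. prob (\<Inter>m. B m) \<le> (\<Sum>i. c (m + i)) / \<epsilon>\<^sup>2" by blast
    qed
    then have "prob (\<Inter>m. B m) = 0" by (simp add: order.antisym)
    then have "AE \<omega> in M. \<omega> \<notin> (\<Inter>m. B m)" by (subst prob_eq_0[symmetric]) auto
    then show ?thesis
      using AE_space by eventually_elim (auto simp: B_def not_less)
  qed
  have "AE \<omega> in M. \<forall>q::nat. \<exists>m. \<forall>j. norm (S (m + j) \<omega> - S m \<omega>) \<le> 1 / real (Suc q)"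
    unfolding AE_all_countable by (intro allI small) simp
  then show ?thesis
  proof eventually_elim
    case (elim \<omega>)
    have "Cauchy (\<lambda>n. S n \<omega>)"
    proof (rule CauchyI)
      fix e :: real assume "0 < e"
      then obtain q :: nat where q: "1 / real (Suc q) < e / 2"
        using nat_approx_posE[of "e / 2"] by auto
      obtain m where m: "\<And>j. norm (S (m + j) \<omega> - S m \<omega>) \<le> 1 / real (Suc q)" using elim by blast
      have "norm (S i \<omega> - S j \<omega>) < e" if "i \<ge> m" "j \<ge> m" for i j
      proof -
        have "norm (S i \<omega> - S m \<omega>) < e / 2" "norm (S j \<omega> - S m \<omega>) < e / 2"
          using m[of "i - m"] m[of "j - m"] that q by simp_all
        then show ?thesis
          using norm_diff_triangle_less[of "S i \<omega>" "S m \<omega>" "e / 2" "S j \<omega>" "e / 2"]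
          by (simp add: norm_minus_commute)
      qed
      then show "\<exists>m. \<forall>i\<ge>m. \<forall>j\<ge>m. norm (S i \<omega> - S j \<omega>) < e" by blast
    qed
    then show ?case unfolding S_def by (simp add: Cauchy_convergent_iff)
  qed
qed

text \<open>The bound passes from \<open>S\<^sub>m\<^sub>+\<^sub>n - S\<^sub>m\<close> to the limit by Fatou's lemma.\<close>

lemma second_moment_remainder:
  assumes c: "summable c" and L: "AE \<omega> in M. (\<lambda>n. \<Sum>i<n. V i \<omega>) \<longlonglongrightarrow> L \<omega>"
  shows "(\<integral>\<^sup>+\<omega>. ennreal ((norm (L \<omega> - (\<Sum>i<m. V i \<omega>)))\<^sup>2) \<partial>M) \<le> ennreal (\<Sum>i. c (m + i))"
proof -
  interpret m: martingale_differences M "\<lambda>n. F (m + n)" "\<lambda>n. V (m + n)" "\<lambda>n. c (m + n)"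
    by (rule shifted)
  define T where "T n \<omega> = (\<Sum>i<n. V (m + i) \<omega>)" for n \<omega>
  have [measurable]: "T n \<in> borel_measurable M" for n
    unfolding T_def using m.second_moment_partial_sum(2) by (rule in_Lp_2_measurable)
  have cm: "summable (\<lambda>i. c (m + i))"
    using summable_ignore_initial_segment[OF c, of m] by (simp add: add.commute)
  have split: "(\<Sum>i<m + n. V i \<omega>) - (\<Sum>i<m. V i \<omega>) = T n \<omega>" for n \<omega>
    unfolding T_def by (induction n) simp_all
  have "AE \<omega> in M. ennreal ((norm (L \<omega> - (\<Sum>i<m. V i \<omega>)))\<^sup>2) = liminf (\<lambda>n. ennreal ((norm (T n \<omega>))\<^sup>2))"
    using L
  proof eventually_elim
    case (elim \<omega>)
    have "(\<lambda>n. \<Sum>i<m + n. V i \<omega>) \<longlonglongrightarrow> L \<omega>"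
      using LIMSEQ_ignore_initial_segment[OF elim, of m] by (simp add: add.commute)
    then have "(\<lambda>n. (\<Sum>i<m + n. V i \<omega>) - (\<Sum>i<m. V i \<omega>)) \<longlonglongrightarrow> L \<omega> - (\<Sum>i<m. V i \<omega>)"
      by (intro tendsto_intros)
    then have "(\<lambda>n. ennreal ((norm (T n \<omega>))\<^sup>2)) \<longlonglongrightarrow> ennreal ((norm (L \<omega> - (\<Sum>i<m. V i \<omega>)))\<^sup>2)"
      unfolding split by (intro tendsto_intros)
    then show ?case by (intro lim_imp_Liminf[symmetric]) auto
  qed
  then have "(\<integral>\<^sup>+\<omega>. ennreal ((norm (L \<omega> - (\<Sum>i<m. V i \<omega>)))\<^sup>2) \<partial>M) =
      (\<integral>\<^sup>+\<omega>. liminf (\<lambda>n. ennreal ((norm (T n \<omega>))\<^sup>2)) \<partial>M)"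
    by (rule nn_integral_cong_AE)
  also have "\<dots> \<le> liminf (\<lambda>n. \<integral>\<^sup>+\<omega>. ennreal ((norm (T n \<omega>))\<^sup>2) \<partial>M)"
    by (rule nn_integral_liminf) measurable
  also have "\<dots> \<le> ennreal (\<Sum>i. c (m + i))"
  proof (rule order_trans[OF Liminf_mono[OF always_eventually[OF allI]]])
    fix n
    have "(\<integral>\<^sup>+\<omega>. ennreal ((norm (T n \<omega>))\<^sup>2) \<partial>M) = ennreal (\<integral>\<omega>. (norm (T n \<omega>))\<^sup>2 \<partial>M)"
      unfolding T_def
      by (rule nn_integral_eq_integral[OF in_Lp_2_integrable[OF m.second_moment_partial_sum(2)]]) simp
    also have "\<dots> \<le> ennreal (\<Sum>i<n. c (m + i))"
      unfolding T_def by (intro ennreal_leI m.second_moment_partial_sum(3))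
    also have "\<dots> \<le> ennreal (\<Sum>i. c (m + i))"
      using cm c_nonneg by (intro ennreal_leI sum_le_suminf) auto
    finally show "(\<integral>\<^sup>+\<omega>. ennreal ((norm (T n \<omega>))\<^sup>2) \<partial>M) \<le> ennreal (\<Sum>i. c (m + i))" .
  qed (simp add: Liminf_const)
  finally show ?thesis .
qed

end

section \<open>Gradient descent with martingale noise\<close>

lemma AE_summable:
  fixes u :: "nat \<Rightarrow> 'w \<Rightarrow> real"
  assumes [measurable]: "\<And>n. u n \<in> borel_measurable M" and u: "\<And>n \<omega>. u n \<omega> \<ge> 0"
    and le: "\<And>n. (\<integral>\<^sup>+\<omega>. ennreal (u n \<omega>) \<partial>M) \<le> ennreal (b n)"
    and b: "\<And>n. b n \<ge> 0" "summable b"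
  shows "AE \<omega> in M. summable (\<lambda>n. u n \<omega>)"
proof -
  have "(\<integral>\<^sup>+\<omega>. (\<Sum>n. ennreal (u n \<omega>)) \<partial>M) = (\<Sum>n. \<integral>\<^sup>+\<omega>. ennreal (u n \<omega>) \<partial>M)"
    by (rule nn_integral_suminf) measurable
  also have "\<dots> \<le> (\<Sum>n. ennreal (b n))"
    by (intro suminf_le le) auto
  also have "\<dots> = ennreal (suminf b)" using b by (intro suminf_ennreal2)
  finally have "(\<integral>\<^sup>+\<omega>. (\<Sum>n. ennreal (u n \<omega>)) \<partial>M) \<noteq> \<infinity>"
    by (auto simp: top_unique)
  then have "AE \<omega> in M. (\<Sum>n. ennreal (u n \<omega>)) \<noteq> \<infinity>"
    by (rule nn_integral_noteq_infinite[rotated]) measurable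
  then show ?thesis
    by eventually_elim (use u in \<open>auto intro!: summable_suminf_not_top\<close>)
qed

lemma strongly_converges_L1I:
  fixes u :: "nat \<Rightarrow> 'w \<Rightarrow> 'a::{banach, second_countable_topology}"
  assumes u: "\<And>n. integrable M (u n)" and x: "integrable M x"
    and lim: "(\<lambda>n. \<integral>\<omega>. norm (u n \<omega> - x \<omega>) \<partial>M) \<longlonglongrightarrow> 0"
  shows "strongly_converges_Lp 1 M u x"
proof -
  have "in_Lp 1 M y" if "integrable M y" for y :: "'w \<Rightarrow> 'a"
    using that unfolding in_Lp_def by simp
  moreover have "Lp_norm 1 M y = (\<integral>\<omega>. norm (y \<omega>) \<partial>M)" for y :: "'w \<Rightarrow> 'a"
    unfolding Lp_norm_def by simp
  ultimately show ?thesis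
    unfolding strongly_converges_Lp_def using u x lim by simp
qed

text \<open>Weak lower semicontinuity, from \<open>\<parallel>u - z\<parallel>\<^sup>2 \<ge> 2 inner (u - z) (p - z) - \<parallel>p - z\<parallel>\<^sup>2\<close>, whose
  right-hand side is weakly continuous in \<open>u\<close>.\<close>

lemma weak_limit_dist_le:
  fixes u :: "nat \<Rightarrow> 'a::real_inner"
  assumes "weakly_converges u p"
  shows "ennreal ((norm (p - z))\<^sup>2) \<le> liminf (\<lambda>n. ennreal ((norm (u n - z))\<^sup>2))"
proof -
  have "(\<lambda>n. 2 * (inner (u n) (p - z) - inner z (p - z)) - (norm (p - z))\<^sup>2) \<longlonglongrightarrow>
      2 * (inner p (p - z) - inner z (p - z)) - (norm (p - z))\<^sup>2"
    using assms unfolding weakly_converges_def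
    by (intro tendsto_diff tendsto_mult tendsto_const) blast
  also have "2 * (inner p (p - z) - inner z (p - z)) - (norm (p - z))\<^sup>2 = (norm (p - z))\<^sup>2"
    unfolding power2_norm_eq_inner by (simp add: inner_diff_left)
  finally have "(\<lambda>n. ennreal (2 * (inner (u n) (p - z) - inner z (p - z)) - (norm (p - z))\<^sup>2))
      \<longlonglongrightarrow> ennreal ((norm (p - z))\<^sup>2)" by (rule tendsto_ennrealI)
  then have "ennreal ((norm (p - z))\<^sup>2) =
      liminf (\<lambda>n. ennreal (2 * (inner (u n) (p - z) - inner z (p - z)) - (norm (p - z))\<^sup>2))"
    by (intro lim_imp_Liminf[symmetric]) auto
  also have "\<dots> \<le> liminf (\<lambda>n. ennreal ((norm (u n - z))\<^sup>2))"
  proof (intro Liminf_mono always_eventually allI ennreal_leI)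
    fix n
    have "0 \<le> (norm ((u n - z) - (p - z)))\<^sup>2" by simp
    then show "2 * (inner (u n) (p - z) - inner z (p - z)) - (norm (p - z))\<^sup>2 \<le> (norm (u n - z))\<^sup>2"
      unfolding power2_norm_eq_inner by (simp add: inner_diff_left inner_diff_right inner_commute)
  qed
  finally show ?thesis .
qed

text \<open>Gradient descent with martingale noise, with the step size conditions that the proof uses.
  The last condition ensures that the expectation of \<open>\<Sum> \<gamma>\<^sub>n \<parallel>S - S\<^sub>n\<parallel>\<^sup>2\<close> is finite, where \<open>S\<^sub>n\<close> are
  the partial sums of the noise and \<open>S\<close> is their limit.\<close>

locale noisy_gradient_descent = smooth_convex f \<beta> + martingale_differences M F V c
  for f :: "'a::{real_inner, banach, second_countable_topology} \<Rightarrow> real" and \<beta> :: real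
    and M :: "'w measure" and F V c +
  fixes x :: "nat \<Rightarrow> 'w \<Rightarrow> 'a" and \<gamma> :: "nat \<Rightarrow> real"
  assumes complete: "complete_measure M"
    and argmin: "Argmin f \<noteq> {}"
    and x_0: "in_Lp 2 M (x 0)"
    and x_adapted: "\<And>n. x n \<in> borel_measurable (F n)"
    and x_Suc: "\<And>n \<omega>. x (Suc n) \<omega> = x n \<omega> - \<gamma> n *\<^sub>R A (x n \<omega>) - V n \<omega>"
    and \<gamma>: "\<And>n. 0 \<le> \<gamma> n" "\<And>n. \<gamma> n \<le> 2 * \<beta>" "\<gamma> \<longlonglongrightarrow> 0" "\<not> summable \<gamma>"
    and c_summable: "summable c"
    and \<gamma>_remainder: "summable (\<lambda>n. \<gamma> n * (\<Sum>i. c (n + i)))"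
begin

lemma measurable_x [measurable]: "x n \<in> borel_measurable M"
  using x_adapted sub measurable_from_subalg by blast

lemma grad_norm_le: "z \<in> Argmin f \<Longrightarrow> norm (A w) \<le> norm (w - z) / \<beta>"
  using grad_lipschitz[of w z] unfolding Argmin_iff by simp

lemma grad_in_L2:
  assumes "in_Lp 2 M y"
  shows "in_Lp 2 M (\<lambda>\<omega>. A (y \<omega>))"
proof -
  obtain z where z: "z \<in> Argmin f" using argmin by blast
  have "in_Lp 2 M (\<lambda>\<omega>. (1 / \<beta>) *\<^sub>R (y \<omega> - z))"
    by (intro in_Lp_2_scaleR in_Lp_2_diff assms in_Lp_2_const)
  note in_Lp_2_integrable[OF this]
  moreover have "(\<lambda>\<omega>. A (y \<omega>)) \<in> borel_measurable M"
    using in_Lp_2_measurable[OF assms] by measurable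
  moreover have "AE \<omega> in M. (norm (A (y \<omega>)))\<^sup>2 \<le> (norm ((1 / \<beta>) *\<^sub>R (y \<omega> - z)))\<^sup>2"
    using grad_norm_le[OF z] beta by (intro AE_I2 power_mono) auto
  ultimately show ?thesis by (rule in_Lp_2_bound)
qed

lemma x_in_L2: "in_Lp 2 M (x n)"
proof (induction n)
  case (Suc n)
  have "x (Suc n) = (\<lambda>\<omega>. x n \<omega> - \<gamma> n *\<^sub>R A (x n \<omega>) - V n \<omega>)" using x_Suc by auto
  then show ?case
    using Suc by (simp add: in_Lp_2_diff in_Lp_2_scaleR grad_in_L2 V_L2)
qed (rule x_0)

text \<open>The noise is orthogonal to the noiseless step, which is measurable with respect to the past.\<close>

lemma second_moment_step_x:
  assumes z: "z \<in> Argmin f"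
  shows "(\<integral>\<omega>. (norm (x (Suc n) \<omega> - z))\<^sup>2 \<partial>M) \<le> (\<integral>\<omega>. (norm (x n \<omega> - z))\<^sup>2 \<partial>M) + c n"
proof -
  define w where "w \<omega> = x n \<omega> - \<gamma> n *\<^sub>R A (x n \<omega>) - z" for \<omega>
  have w_meas: "w \<in> borel_measurable (F n)"
    unfolding w_def using x_adapted[of n] by measurable
  have w: "in_Lp 2 M w"
    unfolding w_def by (intro in_Lp_2_diff in_Lp_2_scaleR grad_in_L2 x_in_L2 in_Lp_2_const)
  have "(\<integral>\<omega>. (norm (x (Suc n) \<omega> - z))\<^sup>2 \<partial>M) =
      (\<integral>\<omega>. (norm (w \<omega>))\<^sup>2 - 2 * inner (V n \<omega>) (w \<omega>) + (norm (V n \<omega>))\<^sup>2 \<partial>M)"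
  proof (rule Bochner_Integration.integral_cong[OF refl])
    fix \<omega>
    have "x (Suc n) \<omega> - z = w \<omega> - V n \<omega>" unfolding w_def x_Suc by simp
    then show "(norm (x (Suc n) \<omega> - z))\<^sup>2 =
        (norm (w \<omega>))\<^sup>2 - 2 * inner (V n \<omega>) (w \<omega>) + (norm (V n \<omega>))\<^sup>2"
      unfolding power2_norm_eq_inner
      by (simp add: inner_diff_left inner_diff_right inner_commute)
  qed
  also have "\<dots> = (\<integral>\<omega>. (norm (w \<omega>))\<^sup>2 \<partial>M) - 2 * (\<integral>\<omega>. inner (V n \<omega>) (w \<omega>) \<partial>M)
      + (\<integral>\<omega>. (norm (V n \<omega>))\<^sup>2 \<partial>M)"
    using in_Lp_2_integrable[OF w] in_Lp_2_integrable[OF V_L2[of n]] integrable_inner_L2[OF V_L2 w, of n]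
    by simp
  also have "\<dots> \<le> (\<integral>\<omega>. (norm (w \<omega>))\<^sup>2 \<partial>M) + c n"
    using orth[OF w_meas w] var[of n] by simp
  also have "(\<integral>\<omega>. (norm (w \<omega>))\<^sup>2 \<partial>M) \<le> (\<integral>\<omega>. (norm (x n \<omega> - z))\<^sup>2 \<partial>M)"
  proof (rule integral_mono)
    show "integrable M (\<lambda>\<omega>. (norm (w \<omega>))\<^sup>2)" using w by (rule in_Lp_2_integrable)
    show "integrable M (\<lambda>\<omega>. (norm (x n \<omega> - z))\<^sup>2)"
      by (intro in_Lp_2_integrable in_Lp_2_diff x_in_L2 in_Lp_2_const)
    show "(norm (w \<omega>))\<^sup>2 \<le> (norm (x n \<omega> - z))\<^sup>2" for \<omega>
    proof -
      have "0 \<le> \<gamma> n * (2 * \<beta> - \<gamma> n) * (norm (A (x n \<omega>)))\<^sup>2" using \<gamma>(1,2)[of n] by simp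
      then show ?thesis
        unfolding w_def using gradient_step_Fejer[OF z \<gamma>(1), of "x n \<omega>" n] by linarith
    qed
  qed
  finally show ?thesis by simp
qed

lemma second_moment_bounded:
  assumes z: "z \<in> Argmin f"
  shows "(\<integral>\<omega>. (norm (x n \<omega> - z))\<^sup>2 \<partial>M) \<le> (\<integral>\<omega>. (norm (x 0 \<omega> - z))\<^sup>2 \<partial>M) + suminf c"
proof -
  have "(\<integral>\<omega>. (norm (x n \<omega> - z))\<^sup>2 \<partial>M) \<le> (\<integral>\<omega>. (norm (x 0 \<omega> - z))\<^sup>2 \<partial>M) + (\<Sum>i<n. c i)"
  proof (induction n)
    case (Suc n)
    then show ?case using second_moment_step_x[OF z, of n] by simp
  qed simp
  also have "(\<Sum>i<n. c i) \<le> suminf c" using c_summable c_nonneg by (intro sum_le_suminf) auto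
  finally show ?thesis by simp
qed

lemma AE_pathwise_convergence:
  "AE \<omega> in M. (\<lambda>n. A (x n \<omega>)) \<longlonglongrightarrow> 0 \<and> (\<exists>p\<in>Argmin f. weakly_converges (\<lambda>n. x n \<omega>) p)"
proof -
  define S where "S n \<omega> = (\<Sum>i<n. V i \<omega>)" for n \<omega>
  define L where "L \<omega> = lim (\<lambda>n. S n \<omega>)" for \<omega>
  have [measurable]: "S n \<in> borel_measurable M" for n
    unfolding S_def using second_moment_partial_sum(2) by (rule in_Lp_2_measurable)
  have [measurable]: "L \<in> borel_measurable M" unfolding L_def by measurable
  have L: "AE \<omega> in M. (\<lambda>n. S n \<omega>) \<longlonglongrightarrow> L \<omega>"
    using AE_convergent_partial_sums[OF c_summable]
    unfolding L_def S_def by (simp add: convergent_LIMSEQ_iff)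
  have "AE \<omega> in M. summable (\<lambda>n. \<gamma> n * (norm (L \<omega> - S n \<omega>))\<^sup>2)"
  proof (rule AE_summable)
    have c_shift: "summable (\<lambda>i. c (n + i))" for n
      using summable_ignore_initial_segment[OF c_summable, of n] by (simp add: add.commute)
    show "\<gamma> n * (\<Sum>i. c (n + i)) \<ge> 0" for n
      by (intro mult_nonneg_nonneg \<gamma>(1) suminf_nonneg c_shift c_nonneg)
    show "(\<integral>\<^sup>+\<omega>. ennreal (\<gamma> n * (norm (L \<omega> - S n \<omega>))\<^sup>2) \<partial>M) \<le> ennreal (\<gamma> n * (\<Sum>i. c (n + i)))" for n
    proof -
      have "(\<integral>\<^sup>+\<omega>. ennreal (\<gamma> n * (norm (L \<omega> - S n \<omega>))\<^sup>2) \<partial>M) =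
          ennreal (\<gamma> n) * (\<integral>\<^sup>+\<omega>. ennreal ((norm (L \<omega> - S n \<omega>))\<^sup>2) \<partial>M)"
        by (subst nn_integral_cmult[symmetric]) (auto simp: ennreal_mult \<gamma>(1))
      also have "\<dots> \<le> ennreal (\<gamma> n) * ennreal (\<Sum>i. c (n + i))"
        unfolding S_def
        by (intro mult_left_mono second_moment_remainder[OF c_summable] L[unfolded S_def]) simp
      finally show ?thesis
        using \<gamma>(1) suminf_nonneg[OF c_shift c_nonneg] by (simp add: ennreal_mult)
    qed
  qed (use \<gamma>(1) \<gamma>_remainder in auto)
  with L show ?thesis
  proof eventually_elim
    case (elim \<omega>)
    have step: "x (Suc n) \<omega> + S (Suc n) \<omega> = x n \<omega> + S n \<omega> - \<gamma> n *\<^sub>R A (x n \<omega>)" for n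
      unfolding S_def x_Suc by simp
    show ?case
      using perturbed_gradient_descent[of \<gamma> "\<lambda>n. x n \<omega>" "\<lambda>n. S n \<omega>", OF argmin \<gamma>(1,3,4) step elim]
      by blast
  qed
qed

text \<open>The pathwise limits form a function \<open>xs\<close> by choice. It is measurable because its inner
  products are almost surely limits of measurable functions and the space is complete, and it is
  square integrable by Fatou's lemma. The convergences in the mean follow from the almost sure
  ones and from the bound on second moments.\<close>

theorem convergence:
  "\<exists>xs. in_Lp_on 2 M (Argmin f) xs \<and>
    (strongly_converges_Lp 1 M (\<lambda>n \<omega>. A (x n \<omega>)) (\<lambda>_. 0) \<and>
     strongly_converges_as M (\<lambda>n \<omega>. A (x n \<omega>)) (\<lambda>_. 0)) \<and>
    (weakly_converges_L2 M x xs \<and> weakly_converges_as M x xs) \<and>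
    ((\<forall>z\<in>Argmin f. demiregular_at A z) \<longrightarrow>
       strongly_converges_Lp 1 M x xs \<and> strongly_converges_as M x xs)"
proof -
  obtain z where z: "z \<in> Argmin f" using argmin by blast
  define xs where "xs \<omega> = (SOME p. p \<in> Argmin f \<and> weakly_converges (\<lambda>n. x n \<omega>) p)" for \<omega>
  have grad_as: "AE \<omega> in M. (\<lambda>n. A (x n \<omega>)) \<longlonglongrightarrow> 0"
    using AE_pathwise_convergence by eventually_elim blast
  have xs_as: "AE \<omega> in M. xs \<omega> \<in> Argmin f \<and> weakly_converges (\<lambda>n. x n \<omega>) (xs \<omega>)"
    using AE_pathwise_convergence
  proof eventually_elim
    case (elim \<omega>)
    then have "\<exists>p. p \<in> Argmin f \<and> weakly_converges (\<lambda>n. x n \<omega>) p" by blast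
    then show ?case unfolding xs_def by (rule someI_ex)
  qed
  have [measurable]: "xs \<in> borel_measurable M"
  proof (rule borel_measurable_weakly)
    fix y
    show "(\<lambda>\<omega>. inner (xs \<omega>) y) \<in> borel_measurable M"
    proof (rule complete_measure.borel_measurable_AE_eq[OF complete])
      show "(\<lambda>\<omega>. lim (\<lambda>n. inner (x n \<omega>) y)) \<in> borel_measurable M" by measurable
      show "AE \<omega> in M. inner (xs \<omega>) y = lim (\<lambda>n. inner (x n \<omega>) y)"
        using xs_as unfolding weakly_converges_def
        by eventually_elim (auto intro!: limI[symmetric])
    qed simp
  qed
  define C where "C = (\<integral>\<omega>. (norm (x 0 \<omega> - z))\<^sup>2 \<partial>M) + suminf c"
  have x_z: "in_Lp 2 M (\<lambda>\<omega>. x n \<omega> - z)" for n by (intro in_Lp_2_diff x_in_L2 in_Lp_2_const)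
  have x_z_le: "(\<integral>\<omega>. (norm (x n \<omega> - z))\<^sup>2 \<partial>M) \<le> C" for n
    unfolding C_def by (rule second_moment_bounded[OF z])
  have "0 \<le> (\<integral>\<omega>. (norm (x 0 \<omega> - z))\<^sup>2 \<partial>M)" by simp
  with x_z_le[of 0] have C: "C \<ge> 0" by linarith
  have "(\<integral>\<^sup>+\<omega>. ennreal ((norm (xs \<omega> - z))\<^sup>2) \<partial>M) \<le> ennreal C"
  proof -
    have "(\<integral>\<^sup>+\<omega>. ennreal ((norm (xs \<omega> - z))\<^sup>2) \<partial>M) \<le>
        (\<integral>\<^sup>+\<omega>. liminf (\<lambda>n. ennreal ((norm (x n \<omega> - z))\<^sup>2)) \<partial>M)"
    proof (rule nn_integral_mono_AE)
      show "AE \<omega> in M. ennreal ((norm (xs \<omega> - z))\<^sup>2) \<le> liminf (\<lambda>n. ennreal ((norm (x n \<omega> - z))\<^sup>2))"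
        using xs_as by eventually_elim (erule weak_limit_dist_le[OF conjunct2])
    qed
    also have "\<dots> \<le> liminf (\<lambda>n. \<integral>\<^sup>+\<omega>. ennreal ((norm (x n \<omega> - z))\<^sup>2) \<partial>M)"
      by (rule nn_integral_liminf) measurable
    also have "\<dots> \<le> ennreal C"
    proof (rule order_trans[OF Liminf_mono[OF always_eventually[OF allI]]])
      fix n
      have "(\<integral>\<^sup>+\<omega>. ennreal ((norm (x n \<omega> - z))\<^sup>2) \<partial>M) = ennreal (\<integral>\<omega>. (norm (x n \<omega> - z))\<^sup>2 \<partial>M)"
        by (rule nn_integral_eq_integral[OF in_Lp_2_integrable[OF x_z]]) simp
      also have "\<dots> \<le> ennreal C" by (rule ennreal_leI[OF x_z_le])
      finally show "(\<integral>\<^sup>+\<omega>. ennreal ((norm (x n \<omega> - z))\<^sup>2) \<partial>M) \<le> ennreal C" .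
    qed (simp add: Liminf_const)
    finally show ?thesis .
  qed
  then have xs_z: "in_Lp 2 M (\<lambda>\<omega>. xs \<omega> - z)" and xs_z_le: "(\<integral>\<omega>. (norm (xs \<omega> - z))\<^sup>2 \<partial>M) \<le> C"
    using in_Lp_2_nn_integral[of "\<lambda>\<omega>. xs \<omega> - z" M C] C by simp_all
  have xs_L2: "in_Lp 2 M xs" using in_Lp_2_add[OF xs_z in_Lp_2_const[of z]] by simp
  have x_xs: "in_Lp 2 M (\<lambda>\<omega>. norm (x n \<omega> - xs \<omega>))" for n
    using in_Lp_2_diff[OF x_in_L2[of n] xs_L2] unfolding in_Lp_2_iff by auto
  have x_xs_le: "(\<integral>\<omega>. (norm (x n \<omega> - xs \<omega>))\<^sup>2 \<partial>M) \<le> 4 * C" for n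
  proof -
    have "(\<integral>\<omega>. (norm (x n \<omega> - xs \<omega>))\<^sup>2 \<partial>M) \<le>
        (\<integral>\<omega>. 2 * (norm (x n \<omega> - z))\<^sup>2 + 2 * (norm (xs \<omega> - z))\<^sup>2 \<partial>M)"
    proof (rule integral_mono)
      show "integrable M (\<lambda>\<omega>. (norm (x n \<omega> - xs \<omega>))\<^sup>2)"
        by (intro in_Lp_2_integrable in_Lp_2_diff x_in_L2 xs_L2)
      show "integrable M (\<lambda>\<omega>. 2 * (norm (x n \<omega> - z))\<^sup>2 + 2 * (norm (xs \<omega> - z))\<^sup>2)"
        using in_Lp_2_integrable[OF x_z[of n]] in_Lp_2_integrable[OF xs_z] by simp
      fix \<omega>
      have "(norm (x n \<omega> - xs \<omega>))\<^sup>2 \<le> (norm (x n \<omega> - z) + norm (xs \<omega> - z))\<^sup>2"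
        using norm_triangle_ineq4[of "x n \<omega> - z" "xs \<omega> - z"] by (intro power_mono) auto
      then show "(norm (x n \<omega> - xs \<omega>))\<^sup>2 \<le> 2 * (norm (x n \<omega> - z))\<^sup>2 + 2 * (norm (xs \<omega> - z))\<^sup>2"
        using sum_squares_bound[of "norm (x n \<omega> - z)" "norm (xs \<omega> - z)"] by (simp add: power2_sum)
    qed
    also have "\<dots> = 2 * (\<integral>\<omega>. (norm (x n \<omega> - z))\<^sup>2 \<partial>M) + 2 * (\<integral>\<omega>. (norm (xs \<omega> - z))\<^sup>2 \<partial>M)"
      using in_Lp_2_integrable[OF x_z[of n]] in_Lp_2_integrable[OF xs_z] by simp
    also have "\<dots> \<le> 4 * C" using x_z_le[of n] xs_z_le by simp
    finally show ?thesis .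
  qed
  have "in_Lp_on 2 M (Argmin f) xs"
    unfolding in_Lp_on_def using xs_L2 xs_as by auto
  moreover have "strongly_converges_as M (\<lambda>n \<omega>. A (x n \<omega>)) (\<lambda>_. 0)"
    unfolding strongly_converges_as_def by (rule grad_as)
  moreover have "strongly_converges_Lp 1 M (\<lambda>n \<omega>. A (x n \<omega>)) (\<lambda>_. 0)"
  proof -
    have Z: "in_Lp 2 M (\<lambda>\<omega>. norm (x n \<omega> - z))" for n
      using x_z[of n] unfolding in_Lp_2_iff by auto
    have le: "AE \<omega> in M. norm (A (x n \<omega>)) \<le> norm (x n \<omega> - z) * (1 / \<beta>)" for n
      using grad_norm_le[OF z] by simp
    have L1: "integrable M (\<lambda>\<omega>. A (x n \<omega>))" "(\<lambda>n. \<integral>\<omega>. norm (A (x n \<omega>)) \<partial>M) \<longlonglongrightarrow> 0" for n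
      by (rule integral_norm_tendsto_0[OF _ grad_as le Z x_z_le in_Lp_2_const]; measurable)+
    then show ?thesis by (intro strongly_converges_L1I) simp_all
  qed
  moreover have "weakly_converges_as M x xs"
    unfolding weakly_converges_as_def using xs_as by auto
  moreover have "weakly_converges_L2 M x xs"
    unfolding weakly_converges_L2_def
  proof (intro conjI allI impI x_in_L2 xs_L2)
    fix y :: "'w \<Rightarrow> 'a" assume y: "in_Lp 2 M y"
    have [measurable]: "y \<in> borel_measurable M" using y by (rule in_Lp_2_measurable)
    have y': "in_Lp 2 M (\<lambda>\<omega>. norm (y \<omega>))" using y unfolding in_Lp_2_iff by auto
    have lim: "AE \<omega> in M. (\<lambda>n. inner (x n \<omega> - xs \<omega>) (y \<omega>)) \<longlonglongrightarrow> 0"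
      using xs_as
    proof eventually_elim
      case (elim \<omega>)
      then have "(\<lambda>n. inner (x n \<omega>) (y \<omega>)) \<longlonglongrightarrow> inner (xs \<omega>) (y \<omega>)"
        unfolding weakly_converges_def by blast
      then show ?case unfolding inner_diff_left by (rule LIM_zero)
    qed
    have le: "AE \<omega> in M. norm (inner (x n \<omega> - xs \<omega>) (y \<omega>)) \<le> norm (x n \<omega> - xs \<omega>) * norm (y \<omega>)" for n
      by (simp add: Cauchy_Schwarz_ineq2)
    have "(\<lambda>n. \<integral>\<omega>. norm (inner (x n \<omega> - xs \<omega>) (y \<omega>)) \<partial>M) \<longlonglongrightarrow> 0"
      by (rule integral_norm_tendsto_0[OF _ lim le x_xs x_xs_le y']) measurable
    then have "(\<lambda>n. \<integral>\<omega>. inner (x n \<omega> - xs \<omega>) (y \<omega>) \<partial>M) \<longlonglongrightarrow> 0"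
      by (rule Lim_null_comparison[rotated]) (intro always_eventually allI integral_norm_bound)
    then show "(\<lambda>n. \<integral>\<omega>. inner (x n \<omega>) (y \<omega>) \<partial>M) \<longlonglongrightarrow> (\<integral>\<omega>. inner (xs \<omega>) (y \<omega>) \<partial>M)"
      using integrable_inner_L2[OF x_in_L2 y] integrable_inner_L2[OF xs_L2 y]
      by (simp add: inner_diff_left LIM_zero_iff)
  qed
  moreover have "strongly_converges_Lp 1 M x xs \<and> strongly_converges_as M x xs"
    if demi: "\<forall>z\<in>Argmin f. demiregular_at A z"
  proof
    have as: "AE \<omega> in M. (\<lambda>n. x n \<omega>) \<longlonglongrightarrow> xs \<omega>"
      using xs_as grad_as
    proof eventually_elim
      case (elim \<omega>)
      then have "demiregular_at A (xs \<omega>)" "A (xs \<omega>) = 0" using demi by (auto simp: Argmin_iff)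
      then show ?case using elim unfolding demiregular_at_def by simp
    qed
    then show "strongly_converges_as M x xs" unfolding strongly_converges_as_def .
    have lim: "AE \<omega> in M. (\<lambda>n. x n \<omega> - xs \<omega>) \<longlonglongrightarrow> 0"
      using as by eventually_elim (rule LIM_zero)
    have le: "AE \<omega> in M. norm (x n \<omega> - xs \<omega>) \<le> norm (x n \<omega> - xs \<omega>) * 1" for n by simp
    have "(\<lambda>n. \<integral>\<omega>. norm (x n \<omega> - xs \<omega>) \<partial>M) \<longlonglongrightarrow> 0"
      by (rule integral_norm_tendsto_0[OF _ lim le x_xs x_xs_le in_Lp_2_const]) measurable
    moreover have "integrable M y" if "in_Lp 2 M y" for y :: "'w \<Rightarrow> 'a"
    proof -
      have "integrable M (\<lambda>\<omega>. norm (y \<omega>) * norm (1::real))"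
        by (rule integrable_norm_mult[OF that in_Lp_2_const])
      then show ?thesis using in_Lp_2_measurable[OF that] by (simp add: integrable_norm_iff)
    qed
    ultimately show "strongly_converges_Lp 1 M x xs"
      by (intro strongly_converges_L1I) (auto intro: x_in_L2 xs_L2)
  qed
  ultimately show ?thesis by blast
qed

end

section \<open>Step sizes and the stochastic gradient method\<close>

lemma summable_shifted_powr: "summable (\<lambda>n. (real n + 1) powr s) \<longleftrightarrow> s < -1"
  using summable_Suc_iff[of "\<lambda>n. real n powr s"] summable_real_powr_iff[of s]
  by (simp add: add.commute)

context
  fixes \<beta> \<nu> :: real and \<gamma> :: "nat \<Rightarrow> real"
  assumes \<beta>: "\<beta> > 0" and \<nu>: "2 / 3 < \<nu>" "\<nu> \<le> 1"
    and \<gamma>: "\<And>n. \<gamma> n = 2 * \<beta> / (real n + 1) powr \<nu>"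
begin

lemma step_powr: "\<gamma> n = 2 * \<beta> * (real n + 1) powr - \<nu>"
  unfolding \<gamma> by (simp add: powr_minus divide_inverse)

lemma step_nonneg: "0 \<le> \<gamma> n"
  unfolding step_powr using \<beta> by simp

lemma step_le: "\<gamma> n \<le> 2 * \<beta>"
proof -
  have "1 \<le> (real n + 1) powr \<nu>" using \<nu> by (intro ge_one_powr_ge_zero) auto
  then have "2 * \<beta> / (real n + 1) powr \<nu> \<le> 2 * \<beta> / 1"
    using \<beta> by (intro divide_left_mono) auto
  then show ?thesis unfolding \<gamma> by simp
qed

lemma step_tendsto_0: "\<gamma> \<longlonglongrightarrow> 0"
proof -
  have "(\<lambda>n. 2 * \<beta> * (real n + 1) powr - \<nu>) \<longlonglongrightarrow> 2 * \<beta> * 0"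
  proof (intro tendsto_mult tendsto_const tendsto_neg_powr)
    show "filterlim (\<lambda>n. real n + 1) at_top sequentially"
      using filterlim_compose[OF filterlim_real_sequentially filterlim_Suc] by (simp add: add.commute)
  qed (use \<nu> in simp)
  then show ?thesis unfolding step_powr by simp
qed

lemma step_not_summable: "\<not> summable \<gamma>"
proof
  assume "summable \<gamma>"
  from summable_mult[OF this, of "1 / (2 * \<beta>)"] have "summable (\<lambda>n. (real n + 1) powr - \<nu>)"
    unfolding step_powr using \<beta> by simp
  then show False using \<nu> unfolding summable_shifted_powr by simp
qed

lemma step_square: "(\<gamma> n)\<^sup>2 = 4 * \<beta>\<^sup>2 * (real n + 1) powr (- (2 * \<nu>))"
  unfolding step_powr by (simp add: power_mult_distrib powr_power)

lemma step_square_summable: "summable (\<lambda>n. (\<gamma> n)\<^sup>2)"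
  unfolding step_square
  by (rule summable_mult, unfold summable_shifted_powr) (use \<nu> in simp)

text \<open>For \<open>i \<ge> n\<close> a part of the decay of \<open>\<gamma>\<^sub>i\<^sup>2\<close>, of order \<open>i\<^sup>-\<^sup>2\<^sup>\<nu>\<close>, can be traded for decay in \<open>n\<close>.
  Moving the exponent \<open>\<nu>/2\<close> leaves \<open>-3\<nu>/2\<close> both in \<open>i\<close> and, together with the factor \<open>\<gamma>\<^sub>n\<close>,
  in \<open>n\<close>. So the double sum is dominated by a product of two series, convergent for \<open>\<nu> > 2/3\<close>.\<close>

lemma step_remainder_summable: "summable (\<lambda>n. \<gamma> n * (\<Sum>i. (\<gamma> (n + i))\<^sup>2))"
proof -
  define s where "s = - (3 * \<nu> / 2)"
  have s: "s < -1" using \<nu> unfolding s_def by simp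
  define C where "C = (\<Sum>i. (real i + 1) powr s)"
  have sum: "summable (\<lambda>i. (real i + 1) powr s)" unfolding summable_shifted_powr by (rule s)
  have sq: "(\<gamma> (n + i))\<^sup>2 \<le> 4 * \<beta>\<^sup>2 * (real n + 1) powr (- (\<nu> / 2)) * (real i + 1) powr s" for n i
  proof -
    have "(\<gamma> (n + i))\<^sup>2 = 4 * \<beta>\<^sup>2 * ((real (n + i) + 1) powr (- (\<nu> / 2)) * (real (n + i) + 1) powr s)"
      unfolding step_square powr_add[symmetric] s_def by simp
    also have "\<dots> \<le> 4 * \<beta>\<^sup>2 * ((real n + 1) powr (- (\<nu> / 2)) * (real i + 1) powr s)"
      using \<nu> s by (intro mult_left_mono mult_mono powr_mono2') auto
    finally show ?thesis by simp
  qed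
  have sum_sq: "summable (\<lambda>i. (\<gamma> (n + i))\<^sup>2)" for n
    using summable_ignore_initial_segment[OF step_square_summable, of n] by (simp add: add.commute)
  have tail: "(\<Sum>i. (\<gamma> (n + i))\<^sup>2) \<le> 4 * \<beta>\<^sup>2 * (real n + 1) powr (- (\<nu> / 2)) * C" for n
    unfolding C_def suminf_mult[OF sum, symmetric]
    by (rule suminf_le[OF sq sum_sq summable_mult[OF sum]])
  have "summable (\<lambda>n. 8 * \<beta> ^ 3 * C * (real n + 1) powr s)" by (rule summable_mult[OF sum])
  then show ?thesis
  proof (rule summable_comparison_test'[where N = 0])
    fix n
    have "\<gamma> n * (\<Sum>i. (\<gamma> (n + i))\<^sup>2) \<le> \<gamma> n * (4 * \<beta>\<^sup>2 * (real n + 1) powr (- (\<nu> / 2)) * C)"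
      by (rule mult_left_mono[OF tail step_nonneg])
    also have "\<dots> = 8 * \<beta> ^ 3 * C * ((real n + 1) powr - \<nu> * (real n + 1) powr (- (\<nu> / 2)))"
      unfolding step_powr by (simp add: power3_eq_cube power2_eq_square)
    also have "\<dots> = 8 * \<beta> ^ 3 * C * (real n + 1) powr s"
      unfolding powr_add[symmetric] s_def by simp
    finally show "norm (\<gamma> n * (\<Sum>i. (\<gamma> (n + i))\<^sup>2)) \<le> 8 * \<beta> ^ 3 * C * (real n + 1) powr s"
      using step_nonneg[of n] suminf_nonneg[OF sum_sq[of n]] by simp
  qed
qed

end

lemma is_copy_distr:
  assumes "prob_space M" and copy: "is_copy M K y x"
  shows "distr M K y = distr M K x"
proof (rule measure_eqI)
  interpret prob_space M by fact
  fix B assume "B \<in> sets (distr M K y)"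
  then have B: "B \<in> sets K" by simp
  have "z -` B \<inter> space M = {\<omega> \<in> space M. z \<omega> \<in> B}" for z :: "'a \<Rightarrow> 'b" by auto
  then show "emeasure (distr M K y) B = emeasure (distr M K x) B"
    using copy B unfolding is_copy_def by (simp add: emeasure_distr emeasure_eq_measure)
qed simp

theorem corollary4p6:
  fixes M :: "'w measure"
    and K :: "'k measure"
    and f :: "'a::{real_inner, banach, second_countable_topology} \<Rightarrow> real"
    and g :: "'k \<Rightarrow> 'a \<Rightarrow> real"
    and \<beta> \<xi> \<nu> :: real
    and k :: "'w \<Rightarrow> 'k"
    and kk :: "nat \<Rightarrow> 'w \<Rightarrow> 'k"
    and \<gamma> :: "nat \<Rightarrow> real"
    and x :: "nat \<Rightarrow> 'w \<Rightarrow> 'a"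
  assumes prob: "prob_space M" and complete: "complete_measure M"
    and beta: "\<beta> > 0"
    and f_convex: "convex_on UNIV f"
    and f_diff: "\<And>z. f differentiable (at z)"
    and f_lip: "(1 / \<beta>)-lipschitz_on UNIV (gradient f)"
    and f_argmin: "Argmin f \<noteq> {}"
    and k_rv: "k \<in> measurable M K"
    and xi: "\<xi> > 0"
    and g_diff: "\<And>\<kappa> z. \<kappa> \<in> space K \<Longrightarrow> g \<kappa> differentiable (at z)"
    and g_meas: "(\<lambda>(\<kappa>, z). gradient (g \<kappa>) z) \<in> measurable (K \<Otimes>\<^sub>M borel) borel"
    and g_integrable: "\<And>z. integrable M (\<lambda>\<omega>. gradient (g (k \<omega>)) z)"
    and g_mean: "\<And>z. (\<integral>\<omega>. gradient (g (k \<omega>)) z \<partial>M) = gradient f z"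
    and g_var: "\<And>z. (\<integral>\<^sup>+\<omega>. ennreal ((norm (gradient (g (k \<omega>)) z - gradient f z))\<^sup>2) \<partial>M) \<le> ennreal \<xi>"
    and nu: "2 / 3 < \<nu>" "\<nu> \<le> 1"
    and x0: "in_Lp 2 M (x 0)"
    and kk_copy: "\<And>n. is_copy M K (kk n) k"
    and kk_indep: "\<And>n. indep_of M K (kk n) (sigma_upto M x n)"
    and gamma: "\<And>n. \<gamma> n = 2 * \<beta> / (real n + 1) powr \<nu>"
    and x_Suc: "\<And>n. AE \<omega> in M. x (Suc n) \<omega> = x n \<omega> - \<gamma> n *\<^sub>R gradient (g (kk n \<omega>)) (x n \<omega>)"
  shows "\<exists>xs. in_Lp_on 2 M (Argmin f) xs \<and>
    (strongly_converges_Lp 1 M (\<lambda>n \<omega>. gradient f (x n \<omega>)) (\<lambda>_. 0) \<and>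
     strongly_converges_as M (\<lambda>n \<omega>. gradient f (x n \<omega>)) (\<lambda>_. 0)) \<and>
    (weakly_converges_L2 M x xs \<and> weakly_converges_as M x xs) \<and>
    ((\<forall>z\<in>Argmin f. demiregular_at (gradient f) z) \<longrightarrow>
       strongly_converges_Lp 1 M x xs \<and> strongly_converges_as M x xs)"
proof -
  interpret prob_space M by (rule prob)
  interpret complete_measure M by (rule complete)
  interpret smooth_convex f \<beta>
    by unfold_locales (use beta f_convex f_diff f_lip in auto)
  note step = beta nu gamma
  \<comment> \<open>The noise is defined by the recursion without exceptional sets, so that \<open>V n\<close> is measurable with respect to \<open>x 0, \<dots>, x (n + 1)\<close> and only \<open>V_eq\<close> below holds almost surely.\<close>
  define F where "F n = sigma (space M) (\<Union>i\<le>n. {x i -` B \<inter> space M | B. B \<in> sets borel})" for n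
  define V where "V n \<omega> = x n \<omega> - x (Suc n) \<omega> - \<gamma> n *\<^sub>R A (x n \<omega>)" for n \<omega>
  define c where "c n = (\<gamma> n)\<^sup>2 * \<xi>" for n
  have kk [measurable]: "kk n \<in> measurable M K" for n using kk_copy[of n] unfolding is_copy_def by blast
  have law: "distr M K (kk n) = distr M K k" for n by (rule is_copy_distr[OF prob kk_copy])
  have G_meas: "(\<lambda>w. gradient (g (p w)) (q w)) \<in> borel_measurable N"
    if "p \<in> measurable N K" "q \<in> borel_measurable N" for p q and N :: "'z measure"
    using measurable_compose[OF measurable_Pair[OF that] g_meas] by simp
  have x_meas [measurable]: "x n \<in> borel_measurable M" for n
  proof (induction n)
    case 0
    show ?case using x0 by (rule in_Lp_2_measurable)
  next
    case (Suc n)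
    show ?case
    proof (rule borel_measurable_AE_eq[OF _ x_Suc])
      show "(\<lambda>\<omega>. x n \<omega> - \<gamma> n *\<^sub>R gradient (g (kk n \<omega>)) (x n \<omega>)) \<in> borel_measurable M"
        by (intro borel_measurable_diff borel_measurable_scaleR borel_measurable_const G_meas kk Suc)
    qed simp
  qed
  have generators: "(\<Union>i\<le>n. {x i -` B \<inter> space M | B. B \<in> sets borel}) \<subseteq> Pow (space M)" for n
    by auto
  have sets_F: "sets (F n) = sigma_upto M x n" and space_F: "space (F n) = space M" for n
    unfolding F_def sigma_upto_def
    by (rule sets_measure_of[OF generators], rule space_measure_of[OF generators])
  have sub: "subalgebra M (F n)" for n
    unfolding subalgebra_def space_F sets_F sigma_upto_def
    by (auto intro!: sets.sigma_sets_subset)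
  have x_F: "x i \<in> borel_measurable (F n)" if "i \<le> n" for i n
  proof (rule measurableI)
    fix B :: "'a set" assume "B \<in> sets borel"
    then show "x i -` B \<inter> space (F n) \<in> sets (F n)"
      unfolding space_F sets_F sigma_upto_def using that by (intro sigma_sets.Basic) auto
  qed simp
  have indep: "indep_set (sets (vimage_algebra (space M) (kk n) K)) (sets (F n))" for n
    using kk_indep[of n] unfolding indep_of_def sets_F .
  have V_eq: "AE \<omega> in M. V n \<omega> = \<gamma> n *\<^sub>R (gradient (g (kk n \<omega>)) (x n \<omega>) - A (x n \<omega>))" for n
    using x_Suc[of n] unfolding V_def by eventually_elim (simp add: scaleR_diff_right)
  have V_meas [measurable]: "V n \<in> borel_measurable M" for n unfolding V_def by measurable
  have c: "c n \<ge> 0" for n unfolding c_def using xi by simp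
  have V_nn: "(\<integral>\<^sup>+\<omega>. ennreal ((norm (V n \<omega>))\<^sup>2) \<partial>M) \<le> ennreal (c n)" for n
  proof -
    define \<phi> where "\<phi> p = ennreal ((norm (\<gamma> n *\<^sub>R (gradient (g (fst p)) (snd p) - A (snd p))))\<^sup>2)" for p
    have grad_diff: "(\<lambda>p. gradient (g (fst p)) (snd p)) \<in> borel_measurable (K \<Otimes>\<^sub>M borel)"
      by (intro G_meas) measurable
    have \<phi>_meas: "\<phi> \<in> borel_measurable (K \<Otimes>\<^sub>M borel)"
      unfolding \<phi>_def using grad_diff by measurable
    have "(\<integral>\<^sup>+\<omega>. ennreal ((norm (V n \<omega>))\<^sup>2) \<partial>M) = (\<integral>\<^sup>+\<omega>. \<phi> (kk n \<omega>, x n \<omega>) \<partial>M)"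
      unfolding \<phi>_def using V_eq[of n] by (intro nn_integral_cong_AE) (auto elim!: eventually_mono)
    also have "\<dots> \<le> ennreal (c n)"
    proof (rule freezing_nn_integral[OF kk x_F[OF order_refl] sub indep \<phi>_meas])
      fix w :: 'a
      have "(\<integral>\<^sup>+\<kappa>. \<phi> (\<kappa>, w) \<partial>distr M K (kk n)) = (\<integral>\<^sup>+\<omega>. \<phi> (k \<omega>, w) \<partial>M)"
        unfolding law
        by (rule nn_integral_distr[OF k_rv]) (use measurable_compose[OF measurable_Pair2' \<phi>_meas] in simp)
      also have "\<dots> = (\<integral>\<^sup>+\<omega>. ennreal ((\<gamma> n)\<^sup>2) * ennreal ((norm (gradient (g (k \<omega>)) w - A w))\<^sup>2) \<partial>M)"
        unfolding \<phi>_def by (simp add: power_mult_distrib ennreal_mult)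
      also have "\<dots> = ennreal ((\<gamma> n)\<^sup>2) * (\<integral>\<^sup>+\<omega>. ennreal ((norm (gradient (g (k \<omega>)) w - A w))\<^sup>2) \<partial>M)"
        using borel_measurable_integrable[OF g_integrable[of w]]
        by (intro nn_integral_cmult) simp
      also have "\<dots> \<le> ennreal ((\<gamma> n)\<^sup>2) * ennreal \<xi>"
        by (intro mult_left_mono g_var) simp
      also have "\<dots> = ennreal (c n)"
        unfolding c_def using xi by (simp add: ennreal_mult)
      finally show "(\<integral>\<^sup>+\<kappa>. \<phi> (\<kappa>, w) \<partial>distr M K (kk n)) \<le> ennreal (c n)" .
    qed
    finally show ?thesis .
  qed
  note V_L2 = in_Lp_2_nn_integral[OF V_meas V_nn c]
  \<comment> \<open>Here \<open>Y\<close> is frozen together with \<open>x n\<close>, and \<open>g_mean\<close> makes the inner average vanish.\<close>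
  have orth: "(\<integral>\<omega>. inner (V n \<omega>) (Y \<omega>) \<partial>M) = 0"
    if Y: "Y \<in> borel_measurable (F n)" "in_Lp 2 M Y" for n and Y :: "'w \<Rightarrow> 'a"
  proof -
    define \<phi> where "\<phi> p = inner (\<gamma> n *\<^sub>R (gradient (g (fst p)) (fst (snd p)) - A (fst (snd p)))) (snd (snd p))"
      for p :: "'k \<times> 'a \<times> 'a"
    have grad_diff: "(\<lambda>p. gradient (g (fst p)) (fst (snd p))) \<in> borel_measurable (K \<Otimes>\<^sub>M (borel \<Otimes>\<^sub>M (borel :: 'a measure)))"
      by (intro G_meas) measurable
    have \<phi>_meas: "\<phi> \<in> borel_measurable (K \<Otimes>\<^sub>M (borel \<Otimes>\<^sub>M borel))"
      unfolding \<phi>_def using grad_diff by measurable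
    have W: "(\<lambda>\<omega>. (x n \<omega>, Y \<omega>)) \<in> measurable (F n) (borel \<Otimes>\<^sub>M borel)"
      using x_F[OF order_refl] Y(1) by (rule measurable_Pair)
    have [measurable]: "Y \<in> borel_measurable M" using Y(2) by (rule in_Lp_2_measurable)
    have comp_meas: "(\<lambda>\<omega>. \<phi> (kk n \<omega>, x n \<omega>, Y \<omega>)) \<in> borel_measurable M"
      by (rule measurable_compose[OF _ \<phi>_meas]) measurable
    have eq: "AE \<omega> in M. inner (V n \<omega>) (Y \<omega>) = \<phi> (kk n \<omega>, x n \<omega>, Y \<omega>)"
      using V_eq[of n] unfolding \<phi>_def by eventually_elim simp
    have inner_meas: "(\<lambda>\<omega>. inner (V n \<omega>) (Y \<omega>)) \<in> borel_measurable M" by measurable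
    have "(\<integral>\<omega>. inner (V n \<omega>) (Y \<omega>) \<partial>M) = (\<integral>\<omega>. \<phi> (kk n \<omega>, x n \<omega>, Y \<omega>) \<partial>M)"
      using inner_meas comp_meas eq by (rule integral_cong_AE)
    also have "\<dots> = 0"
    proof (rule freezing_integral_0[OF kk W sub indep \<phi>_meas])
      show "integrable M (\<lambda>\<omega>. \<phi> (kk n \<omega>, x n \<omega>, Y \<omega>))"
        using integrable_inner_L2[OF V_L2(1) Y(2)] integrable_cong_AE[OF inner_meas comp_meas eq] by blast
    next
      fix w :: "'a \<times> 'a"
      have "(\<integral>\<kappa>. \<phi> (\<kappa>, w) \<partial>distr M K (kk n)) = (\<integral>\<omega>. \<phi> (k \<omega>, w) \<partial>M)"
        unfolding law
        by (rule integral_distr[OF k_rv])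
          (use measurable_compose[OF measurable_Pair2' \<phi>_meas, of w] in \<open>simp add: space_pair_measure\<close>)
      also have "\<dots> = inner (\<gamma> n *\<^sub>R ((\<integral>\<omega>. gradient (g (k \<omega>)) (fst w) \<partial>M) - A (fst w))) (snd w)"
        unfolding \<phi>_def using g_integrable[of "fst w"] by (simp add: prob_space)
      finally show "(\<integral>\<kappa>. \<phi> (\<kappa>, w) \<partial>distr M K (kk n)) = 0" unfolding g_mean by simp
    qed
    finally show ?thesis .
  qed
  interpret noisy_gradient_descent f \<beta> M F V c x \<gamma>
  proof unfold_locales
    show "subalgebra M (F n)" for n by (rule sub)
    show "sets (F n) \<subseteq> sets (F (Suc n))" for n
      unfolding sets_F sigma_upto_def by (rule sigma_sets_mono', rule UN_mono) auto
    show "V n \<in> borel_measurable (F (Suc n))" for n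
      unfolding V_def using x_F[of n "Suc n"] x_F[of "Suc n" "Suc n"] by measurable
    show "in_Lp 2 M (V n)" for n by (rule V_L2(1))
    show "(\<integral>\<omega>. inner (V n \<omega>) (Y \<omega>) \<partial>M) = 0" if "Y \<in> borel_measurable (F n)" "in_Lp 2 M Y" for n Y
      using that by (rule orth)
    show "(\<integral>\<omega>. (norm (V n \<omega>))\<^sup>2 \<partial>M) \<le> c n" for n by (rule V_L2(2))
    show "Argmin f \<noteq> {}" by (rule f_argmin)
    show "in_Lp 2 M (x 0)" by (rule x0)
    show "x n \<in> borel_measurable (F n)" for n by (rule x_F) simp
    show "x (Suc n) \<omega> = x n \<omega> - \<gamma> n *\<^sub>R A (x n \<omega>) - V n \<omega>" for n \<omega> unfolding V_def by simp
    show "0 \<le> \<gamma> n" "\<gamma> n \<le> 2 * \<beta>" "\<gamma> \<longlonglongrightarrow> 0" "\<not> summable \<gamma>" for n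
      by (rule step_nonneg[OF step] step_le[OF step] step_tendsto_0[OF step] step_not_summable[OF step])+
    show "summable c"
      unfolding c_def by (rule summable_mult2[OF step_square_summable[OF step]])
    have "(\<Sum>i. c (n + i)) = (\<Sum>i. (\<gamma> (n + i))\<^sup>2) * \<xi>" for n
      unfolding c_def
      using summable_ignore_initial_segment[OF step_square_summable[OF step], of n]
      by (intro suminf_mult2[symmetric]) (simp add: add.commute)
    then show "summable (\<lambda>n. \<gamma> n * (\<Sum>i. c (n + i)))"
      using summable_mult2[OF step_remainder_summable[OF step], of \<xi>] by (simp add: mult.assoc)
  qed
  show ?thesis by (rule convergence)
qed

end
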